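(* Let $(K,V_i)_{i=0}^{N-1}$ be a row co-isometry, and suppose that: (A1) there is a continuous map $e:\mathcal T\to K$, $t\mapsto e_t$, from a complete metric space $\mathcal T$, such that $\overline{\operatorname{span}}\{e_t:t\in\mathcal T\}=K$ and $\|e_t\|=1$ for all $t\in\mathcal T$; (A2) for every $i\in\{0,\dots,N-1\}$ and $t\in\mathcal T$, $V_i^*e_t=\nu_i(t)e_{g_i(t)}$ for some $\nu_i(t)\in\mathbb C$ and $g_i(t)\in\mathcal T$; (A3) the maps $g_i:\mathcal T\to\mathcal T$ are contractions. Assume in addition that the maps $g_i$ are one-to-one and that all the minimal compact invariant sets are finite. Let $M_1,\dots,M_p$ be the complete list of minimal compact invariant sets (there are finitely many of them), and pick a point $c_j\in M_j$ for every $j=1,\dots,p$. Then $(V_i)$ acts as an irreducible, separating random walk $(M_j,\{g_i|_{M_j}\},\{\nu_i|_{M_j}\})$ on the space $K(M_j)$, with orthonormal basis $(e_t)_{t\in M_j}$, for every $j$. If $(V_i)$ is reversing on each $K(M_j)$, then $\{V_\omega e_{c_j}:\omega\in\Omega_{c_j}^{(0)},\ j=1,\dots,p\}$ is a Parseval frame for $K$.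
   Context: Row co-isometry: a Hilbert space $K$ with bounded operators $V_0,\dots,V_{N-1}$ on $K$ ($N\ge 2$) satisfying $\sum_{i=0}^{N-1}V_iV_i^*=I_K$. $\Omega$ is the set of all finite words over $\{0,\dots,N-1\}$ including the empty word; for $\omega=\omega_1\cdots\omega_n$, $V_\omega=V_{\omega_1}\cdots V_{\omega_n}$, $V_\emptyset=I$. $g:\mathcal T\to\mathcal T$ is a contraction if there is $0<c<1$ with $d(g(x),g(y))\le c\,d(x,y)$ for all $x,y$. The transition $t\to g_i(t)$ is possible if $\nu_i(t)\ne0$. A subset $M\subseteq\mathcal T$ is invariant if for all $t\in M$ and $i$, $\nu_i(t)\neq0$ implies $g_i(t)\in M$. A nonempty closed invariant set is minimal if it has no nonempty proper closed invariant subset; a minimal compact invariant set is a compact invariant set that is minimal. For an invariant set $M$, $K(M)=\overline{\operatorname{span}}\{e_t:t\in M\}$. $(V_i)$ acts on a closed subspace $K_0\subseteq K$ as a random walk $(M,\{g_i\},\{\nu_i\})$ if: (1) $V_i^*K_0\subseteq K_0$ for all $i$; (2) there are an orthonormal basis $(e_c)_{c\in M}$ of $K_0$ with $M$ finite, and maps $\nu_i:M\to\mathbb C$, $g_i:M\to M$ with $V_i^*e_c=\nu_i(c)e_{g_i(c)}$ for all $i$ and $c\in M$; (3) whenever $\nu_i(c_1)\ne0$, $\nu_i(c_2)\ne 0$ and $g_i(c_1)=g_i(c_2)$, then $c_1=c_2$. Convention for $g_i|_{M_j}$: if $t\in M_j$ and $\nu_i(t)=0$, the point $g_i(t)$ need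 not lie in $M_j$, and then the value of $g_i|_{M_j}$ at $t$ is taken to be an arbitrary element of $M_j$; none of the notions below depends on this choice. For $\omega=\omega_1\cdots\omega_n$: $g_\omega=g_{\omega_n}\circ\cdots\circ g_{\omega_1}$ and $\nu_\omega(c)=\nu_{\omega_1}(c)\nu_{\omega_2}(g_{\omega_1}(c))\cdots\nu_{\omega_n}(g_{\omega_{n-1}}\cdots g_{\omega_1}(c))$; $g_\emptyset=\mathrm{id}$, $\nu_\emptyset=1$. The random walk is irreducible if for all $c_1,c_2\in M$ there is $\omega\in\Omega$ with $g_\omega(c_1)=c_2$ and $\nu_\omega(c_1)\neq0$. It is separating if for any $c_1\ne c_2$ in $M$ there is $n$ such that for all $\omega\in\Omega$ of length at least $n$, $\nu_\omega(c_1)=0$ or $\nu_\omega(c_2)=0$. $(V_i)$ is reversing on the random walk (on $K_0$) if $V_ie_{g_i(c)}=\overline{\nu_i(c)}e_c$ whenever $c\in M$ and $\nu_i(c)\ne0$. A nonempty word $\beta=\beta_0\cdots\beta_{p'-1}$ is a cycle word for $c$ if $g_\beta(c)=c$, $\nu_\beta(c)\neq0$ and $g_{\beta_k}\cdots g_{\beta_0}(c)\ne c$ for $0\le k<p'-1$. $\Omega_{c}^{(0)}$ is the set of words in $\Omega$ (including the empty word) that do not end in a cycle word for $c$. A family $\{f_j\}_{j\in J}$ is a Parseval frame for $K$ if $\|v\|^2=\sum_j|\langle v,f_j\rangle|^2$ for all $v\in K$. *)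

theory Defs
  imports "HOL-Analysis.Analysis"
begin

text \<open>
  A complex Hilbert space, built on top of the library's real inner product spaces: the real
  inner product is the real part of the complex one, so the norm is the one of \<open>cinner\<close>.
  The inner product is linear in the first argument.
\<close>

class complex_hilbert = real_inner + complete_space +
  fixes scaleC :: "complex \<Rightarrow> 'a \<Rightarrow> 'a" (infixr "*\<^sub>C" 75)
    and cinner :: "'a \<Rightarrow> 'a \<Rightarrow> complex"
  assumes scaleC_add_right: "a *\<^sub>C (x + y) = a *\<^sub>C x + a *\<^sub>C y"
    and scaleC_add_left: "(a + b) *\<^sub>C x = a *\<^sub>C x + b *\<^sub>C x"
    and scaleC_scaleC: "a *\<^sub>C (b *\<^sub>C x) = (a * b) *\<^sub>C x"
    and scaleR_scaleC: "r *\<^sub>R x = complex_of_real r *\<^sub>C x"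
    and cinner_commute: "cinner x y = cnj (cinner y x)"
    and cinner_add_left: "cinner (x + y) z = cinner x z + cinner y z"
    and cinner_scaleC_left: "cinner (a *\<^sub>C x) y = a * cinner x y"
    and inner_eq_Re_cinner: "inner x y = Re (cinner x y)"

lemma cinner_self:
  fixes x :: "'a::complex_hilbert"
  shows "cinner x x = complex_of_real ((norm x)\<^sup>2)"
proof -
  have "Im (cinner x x) = 0"
    using arg_cong[OF cinner_commute[of x x], of Im] by simp
  then show ?thesis
    by (simp add: complex_eq_iff power2_norm_eq_inner inner_eq_Re_cinner)
qed

instantiation complex :: complex_hilbert
begin
definition scaleC_complex :: "complex \<Rightarrow> complex \<Rightarrow> complex"
  where "scaleC_complex a x = a * x"
definition cinner_complex :: "complex \<Rightarrow> complex \<Rightarrow> complex"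
  where "cinner_complex x y = x * cnj y"
instance
  by standard
    (auto simp: scaleC_complex_def cinner_complex_def inner_complex_def algebra_simps
       scaleR_conv_of_real)
end

global_interpretation complex_vector:
  vector_space "scaleC :: complex \<Rightarrow> 'a \<Rightarrow> 'a::complex_hilbert"
proof
  fix x :: 'a
  show "1 *\<^sub>C x = x"
    using scaleR_scaleC[of 1 x] by simp
qed (simp_all add: scaleC_add_right scaleC_add_left scaleC_scaleC)

definition closed_cspan :: "'k::complex_hilbert set \<Rightarrow> 'k set"
  where "closed_cspan S = closure (complex_vector.span S)"

definition bounded_clinear :: "('k::complex_hilbert \<Rightarrow> 'k) \<Rightarrow> bool"
  where "bounded_clinear A \<longleftrightarrow> bounded_linear A \<and> (\<forall>a x. A (a *\<^sub>C x) = a *\<^sub>C A x)"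

text \<open>Only meaningful for bounded operators, where the Riesz theorem gives a unique such map.\<close>

definition cadjoint :: "('k::complex_hilbert \<Rightarrow> 'k) \<Rightarrow> 'k \<Rightarrow> 'k"
  where "cadjoint A = (THE B. \<forall>x y. cinner (A x) y = cinner x (B y))"

definition parseval_frame :: "'j set \<Rightarrow> ('j \<Rightarrow> 'k::complex_hilbert) \<Rightarrow> bool"
  where "parseval_frame J f \<longleftrightarrow>
    (\<forall>v. ((\<lambda>j. (cmod (cinner v (f j)))\<^sup>2) has_sum (norm v)\<^sup>2) J)"

definition orthonormal_basis_of ::
    "'t set \<Rightarrow> ('t \<Rightarrow> 'k::complex_hilbert) \<Rightarrow> 'k set \<Rightarrow> bool"
  where "orthonormal_basis_of M e K0 \<longleftrightarrow>
    (\<forall>s\<in>M. \<forall>t\<in>M. cinner (e s) (e t) = (if s = t then 1 else 0)) \<and>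
    closed_cspan (e ` M) = K0"

definition row_coisometry :: "nat \<Rightarrow> (nat \<Rightarrow> 'k::complex_hilbert \<Rightarrow> 'k) \<Rightarrow> bool"
  where "row_coisometry N V \<longleftrightarrow> N \<ge> 2 \<and> (\<forall>i<N. bounded_clinear (V i)) \<and>
    (\<forall>x. (\<Sum>i<N. V i (cadjoint (V i) x)) = x)"

definition is_contraction :: "('t::metric_space \<Rightarrow> 't) \<Rightarrow> bool"
  where "is_contraction f \<longleftrightarrow> (\<exists>c. 0 < c \<and> c < 1 \<and> (\<forall>x y. dist (f x) (f y) \<le> c * dist x y))"

definition words :: "nat \<Rightarrow> nat list set"
  where "words N = lists {..<N}"

text \<open>
  The operators of a word are composed from left to right, \<open>V_w = V_{w1} ... V_{wn}\<close>, whereas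
  the maps of a word are applied starting with the first letter,
  \<open>g_w = g_{wn} o ... o g_{w1}\<close>.
\<close>

primrec word_op :: "(nat \<Rightarrow> 'k \<Rightarrow> 'k) \<Rightarrow> nat list \<Rightarrow> 'k \<Rightarrow> 'k"
  where
    "word_op V [] x = x"
  | "word_op V (i # w) x = V i (word_op V w x)"

primrec word_map :: "(nat \<Rightarrow> 't \<Rightarrow> 't) \<Rightarrow> nat list \<Rightarrow> 't \<Rightarrow> 't"
  where
    "word_map g [] t = t"
  | "word_map g (i # w) t = word_map g w (g i t)"

primrec word_coeff ::
    "(nat \<Rightarrow> 't \<Rightarrow> 't) \<Rightarrow> (nat \<Rightarrow> 't \<Rightarrow> complex) \<Rightarrow> nat list \<Rightarrow> 't \<Rightarrow> complex"
  where
    "word_coeff g \<nu> [] t = 1"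
  | "word_coeff g \<nu> (i # w) t = \<nu> i t * word_coeff g \<nu> w (g i t)"

definition invariant_set ::
    "nat \<Rightarrow> (nat \<Rightarrow> 't \<Rightarrow> 't) \<Rightarrow> (nat \<Rightarrow> 't \<Rightarrow> complex) \<Rightarrow> 't set \<Rightarrow> bool"
  where "invariant_set N g \<nu> M \<longleftrightarrow> (\<forall>t\<in>M. \<forall>i<N. \<nu> i t \<noteq> 0 \<longrightarrow> g i t \<in> M)"

definition minimal_invariant_set ::
    "nat \<Rightarrow> (nat \<Rightarrow> 't::topological_space \<Rightarrow> 't) \<Rightarrow> (nat \<Rightarrow> 't \<Rightarrow> complex) \<Rightarrow> 't set \<Rightarrow> bool"
  where "minimal_invariant_set N g \<nu> M \<longleftrightarrow>
    M \<noteq> {} \<and> closed M \<and> invariant_set N g \<nu> M \<and>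
    \<not> (\<exists>M'. M' \<noteq> {} \<and> M' \<subset> M \<and> closed M' \<and> invariant_set N g \<nu> M')"

definition minimal_compact_invariant_set ::
    "nat \<Rightarrow> (nat \<Rightarrow> 't::topological_space \<Rightarrow> 't) \<Rightarrow> (nat \<Rightarrow> 't \<Rightarrow> complex) \<Rightarrow> 't set \<Rightarrow> bool"
  where "minimal_compact_invariant_set N g \<nu> M \<longleftrightarrow>
    compact M \<and> minimal_invariant_set N g \<nu> M"

definition acts_as_random_walk ::
    "nat \<Rightarrow> (nat \<Rightarrow> 'k::complex_hilbert \<Rightarrow> 'k) \<Rightarrow> 'k set \<Rightarrow> 't set \<Rightarrow> ('t \<Rightarrow> 'k) \<Rightarrow>
      (nat \<Rightarrow> 't \<Rightarrow> 't) \<Rightarrow> (nat \<Rightarrow> 't \<Rightarrow> complex) \<Rightarrow> bool"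
  where "acts_as_random_walk N V K0 M e g \<nu> \<longleftrightarrow>
    complex_vector.subspace K0 \<and> closed K0 \<and>
    (\<forall>i<N. cadjoint (V i) ` K0 \<subseteq> K0) \<and>
    finite M \<and> orthonormal_basis_of M e K0 \<and>
    (\<forall>i<N. \<forall>s\<in>M. g i s \<in> M \<and> cadjoint (V i) (e s) = \<nu> i s *\<^sub>C e (g i s)) \<and>
    (\<forall>i<N. \<forall>s\<in>M. \<forall>t\<in>M. \<nu> i s \<noteq> 0 \<longrightarrow> \<nu> i t \<noteq> 0 \<longrightarrow> g i s = g i t \<longrightarrow> s = t)"

definition irreducible_walk ::
    "nat \<Rightarrow> 't set \<Rightarrow> (nat \<Rightarrow> 't \<Rightarrow> 't) \<Rightarrow> (nat \<Rightarrow> 't \<Rightarrow> complex) \<Rightarrow> bool"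
  where "irreducible_walk N M g \<nu> \<longleftrightarrow>
    (\<forall>s\<in>M. \<forall>t\<in>M. \<exists>w\<in>words N. word_map g w s = t \<and> word_coeff g \<nu> w s \<noteq> 0)"

definition separating_walk ::
    "nat \<Rightarrow> 't set \<Rightarrow> (nat \<Rightarrow> 't \<Rightarrow> 't) \<Rightarrow> (nat \<Rightarrow> 't \<Rightarrow> complex) \<Rightarrow> bool"
  where "separating_walk N M g \<nu> \<longleftrightarrow>
    (\<forall>s\<in>M. \<forall>t\<in>M. s \<noteq> t \<longrightarrow>
      (\<exists>n. \<forall>w\<in>words N. n \<le> length w \<longrightarrow> word_coeff g \<nu> w s = 0 \<or> word_coeff g \<nu> w t = 0))"

definition reversing_on ::
    "nat \<Rightarrow> (nat \<Rightarrow> 'k::complex_hilbert \<Rightarrow> 'k) \<Rightarrow> 't set \<Rightarrow> ('t \<Rightarrow> 'k) \<Rightarrow>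
      (nat \<Rightarrow> 't \<Rightarrow> 't) \<Rightarrow> (nat \<Rightarrow> 't \<Rightarrow> complex) \<Rightarrow> bool"
  where "reversing_on N V M e g \<nu> \<longleftrightarrow>
    (\<forall>i<N. \<forall>t\<in>M. \<nu> i t \<noteq> 0 \<longrightarrow> V i (e (g i t)) = cnj (\<nu> i t) *\<^sub>C e t)"

text \<open>
  A point of an invariant set \<open>M\<close> may be sent outside \<open>M\<close> by \<open>g i\<close> when the transition is not
  possible. The restriction of \<open>g i\<close> to \<open>M\<close> is therefore any self-map of \<open>M\<close> that agrees with
  \<open>g i\<close> along the possible transitions.
\<close>

definition is_walk_restriction ::
    "nat \<Rightarrow> (nat \<Rightarrow> 't \<Rightarrow> 't) \<Rightarrow> (nat \<Rightarrow> 't \<Rightarrow> complex) \<Rightarrow> 't set \<Rightarrow> (nat \<Rightarrow> 't \<Rightarrow> 't) \<Rightarrow> bool"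
  where "is_walk_restriction N g \<nu> M h \<longleftrightarrow>
    (\<forall>i<N. \<forall>t\<in>M. h i t \<in> M \<and> (\<nu> i t \<noteq> 0 \<longrightarrow> h i t = g i t))"

lemma is_walk_restriction_exists:
  assumes "invariant_set N g \<nu> M" and "M \<noteq> {}"
  shows "\<exists>h. is_walk_restriction N g \<nu> M h"
proof -
  obtain a where "a \<in> M"
    using assms(2) by blast
  then have "is_walk_restriction N g \<nu> M (\<lambda>i t. if \<nu> i t = 0 then a else g i t)"
    using assms(1) by (simp add: is_walk_restriction_def invariant_set_def)
  then show ?thesis
    by blast
qed

definition cycle_word ::
    "nat \<Rightarrow> (nat \<Rightarrow> 't \<Rightarrow> 't) \<Rightarrow> (nat \<Rightarrow> 't \<Rightarrow> complex) \<Rightarrow> 't \<Rightarrow> nat list \<Rightarrow> bool"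
  where "cycle_word N g \<nu> c b \<longleftrightarrow>
    b \<in> words N \<and> b \<noteq> [] \<and> word_map g b c = c \<and> word_coeff g \<nu> b c \<noteq> 0 \<and>
    (\<forall>k. 0 < k \<and> k < length b \<longrightarrow> word_map g (take k b) c \<noteq> c)"

definition words_no_final_cycle ::
    "nat \<Rightarrow> (nat \<Rightarrow> 't \<Rightarrow> 't) \<Rightarrow> (nat \<Rightarrow> 't \<Rightarrow> complex) \<Rightarrow> 't \<Rightarrow> nat list set"
  where "words_no_final_cycle N g \<nu> c =
    {w \<in> words N. \<not> (\<exists>a b. w = a @ b \<and> cycle_word N g \<nu> c b)}"

end

theory Submission imports Defs begin

text \<open>
  Write \<open>W\<^sub>i = V\<^sub>i\<^sup>*\<close>, \<open>W\<^sub>w = W\<^bsub>w\<^sub>n\<^esub> \<dots> W\<^bsub>w\<^sub>1\<^esub>\<close> and let \<open>M\<close> be the union of the minimal compact invariant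
  sets. Contractivity and injectivity of the \<open>g\<^sub>i\<close> separate the points of a finite invariant set, so
  the \<open>e\<^sub>s\<close> with \<open>s \<in> M\<close> are orthonormal. As every minimal set meets a fixed compact orbit closure,
  continuity of \<open>e\<close> forces \<open>M\<close> to be finite.

  For the frame, consider the masses \<open>|\<langle>W\<^sub>w v, e\<^sub>d\<rangle>|\<^sup>2\<close> with \<open>d \<in> M\<close>. Reversibility gives
  \<open>\<langle>W\<^sub>i x, e\<^bsub>g\<^sub>i s\<^esub>\<rangle> = \<nu>\<^sub>i(s) \<langle>x, e\<^sub>s\<rangle>\<close>, so mass is transported along the walk without loss and the total
  mass of the words of length \<open>n\<close> increases with \<open>n\<close>. The words without final cycle are those at
  which a piece of mass visits \<open>c\<^sub>j\<close> for the first time, and by irreducibility the mass that has not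
  yet visited any \<open>c\<^sub>j\<close> tends to \<open>0\<close>; hence the frame sum is the limit of the total masses. At \<open>e\<^sub>t\<close>
  this limit is a continuous harmonic function of \<open>t\<close> that equals \<open>1\<close> on \<open>M\<close>, hence is \<open>1\<close> everywhere
  by a minimum principle, and so the limit is \<open>\<parallel>v\<parallel>\<^sup>2\<close> for all \<open>v\<close>.
\<close>

section \<open>Complex Hilbert spaces and adjoints\<close>

lemma cinner_add_right: "cinner x (y + z) = cinner x y + cinner (x::'k::complex_hilbert) z"
  by (metis cinner_commute cinner_add_left complex_cnj_add)

lemma cinner_scaleC_right: "cinner x (a *\<^sub>C y) = cnj a * cinner (x::'k::complex_hilbert) y"
  by (metis cinner_commute cinner_scaleC_left complex_cnj_mult)

lemma cinner_zero_left [simp]: "cinner 0 (x::'k::complex_hilbert) = 0"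
  using cinner_add_left[of 0 0 x] by simp

lemma cinner_zero_right [simp]: "cinner (x::'k::complex_hilbert) 0 = 0"
  using cinner_add_right[of x 0 0] by simp

lemma cinner_minus_left [simp]: "cinner (- x) (y::'k::complex_hilbert) = - cinner x y"
  using cinner_add_left[of x "- x" y] by (simp add: eq_neg_iff_add_eq_0 add.commute)

lemma cinner_minus_right [simp]: "cinner (x::'k::complex_hilbert) (- y) = - cinner x y"
  using cinner_add_right[of x y "- y"] by (simp add: eq_neg_iff_add_eq_0 add.commute)

lemma cinner_diff_left: "cinner (x - y) (z::'k::complex_hilbert) = cinner x z - cinner y z"
  using cinner_add_left[of x "- y" z] by simp

lemma cinner_diff_right: "cinner (x::'k::complex_hilbert) (y - z) = cinner x y - cinner x z"
  using cinner_add_right[of x y "- z"] by simp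

lemma cinner_sum_left: "cinner (\<Sum>i\<in>A. f i) (y::'k::complex_hilbert) = (\<Sum>i\<in>A. cinner (f i) y)"
  by (induction A rule: infinite_finite_induct) (auto simp: cinner_add_left)

lemma cinner_sum_right: "cinner (y::'k::complex_hilbert) (\<Sum>i\<in>A. f i) = (\<Sum>i\<in>A. cinner y (f i))"
  by (induction A rule: infinite_finite_induct) (auto simp: cinner_add_right)

lemma norm_scaleC: "norm (a *\<^sub>C x) = cmod a * norm (x::'k::complex_hilbert)"
proof -
  have "complex_of_real ((norm (a *\<^sub>C x))\<^sup>2) = (a * cnj a) * cinner x x"
    by (simp only: cinner_self[symmetric] cinner_scaleC_left cinner_scaleC_right mult_ac)
  also have "\<dots> = complex_of_real ((cmod a * norm x)\<^sup>2)"
    by (simp only: cinner_self complex_norm_square[symmetric] power_mult_distrib of_real_mult of_real_power)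
  finally show ?thesis
    by (simp only: of_real_eq_iff power2_eq_iff_nonneg norm_ge_zero mult_nonneg_nonneg)
qed

lemma cinner_eq_0_all: "(\<And>x. cinner x (y::'k::complex_hilbert) = 0) \<Longrightarrow> y = 0"
  by (metis cinner_self norm_eq_zero of_real_eq_0_iff zero_eq_power2)

lemma norm_parallelogram:
  "(norm (a + b))\<^sup>2 + (norm (a - b))\<^sup>2 = 2 * (norm a)\<^sup>2 + 2 * (norm (b::'k::real_inner))\<^sup>2"
  by (simp add: power2_norm_eq_inner inner_simps inner_commute algebra_simps)

text \<open>\<open>p\<close> is the orthogonal projection of \<open>x\<close> onto the span of the
  \<open>e d\<close>. Expanding \<open>cinner (x - p) (x - p)\<close> leaves the square of
  \<open>norm x\<close> minus \<open>q\<close>, which cannot be negative.\<close>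

lemma bessel:
  fixes e :: "'t \<Rightarrow> 'k::complex_hilbert"
  assumes "finite M" and orth: "\<And>s t. s \<in> M \<Longrightarrow> t \<in> M \<Longrightarrow> cinner (e s) (e t) = (if s = t then 1 else 0)"
  shows "(\<Sum>d\<in>M. (cmod (cinner x (e d)))\<^sup>2) \<le> (norm x)\<^sup>2"
proof -
  define p where "p = (\<Sum>d\<in>M. cinner x (e d) *\<^sub>C e d)"
  define q where "q = (\<Sum>d\<in>M. (cmod (cinner x (e d)))\<^sup>2)"
  have pe: "cinner p (e d) = cinner x (e d)" if "d \<in> M" for d
    using that \<open>finite M\<close>
    by (simp add: p_def cinner_sum_left cinner_scaleC_left orth if_distrib sum.delta cong: if_cong)
  have xp: "cinner x p = complex_of_real q"
    by (simp add: p_def q_def cinner_sum_right cinner_scaleC_right complex_norm_square mult.commute del: of_real_power)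
  have pp: "cinner p p = complex_of_real q"
  proof -
    have "cinner p p = (\<Sum>d\<in>M. cnj (cinner x (e d)) * cinner p (e d))"
      by (subst (2) p_def) (simp add: cinner_sum_right cinner_scaleC_right)
    also have "\<dots> = (\<Sum>d\<in>M. cnj (cinner x (e d)) * cinner x (e d))"
      by (intro sum.cong refl) (simp add: pe)
    also have "\<dots> = complex_of_real q"
      by (simp add: q_def complex_norm_square mult.commute del: of_real_power)
    finally show ?thesis .
  qed
  have px: "cinner p x = complex_of_real q"
    using xp by (metis cinner_commute complex_cnj_complex_of_real)
  have "complex_of_real ((norm (x - p))\<^sup>2) = complex_of_real ((norm x)\<^sup>2 - q)"
    by (simp only: cinner_self[symmetric] of_real_diff) (simp add: cinner_diff_left cinner_diff_right xp pp px)
  then have "(norm (x - p))\<^sup>2 = (norm x)\<^sup>2 - q"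
    by (simp only: of_real_eq_iff)
  then show ?thesis
    unfolding q_def[symmetric] by (metis diff_ge_0_iff_ge zero_le_power2)
qed

text \<open>The representing vector minimises \<open>\<parallel>x\<parallel>\<^sup>2 - 2 f x\<close>; by the parallelogram law every minimising
  sequence is Cauchy.\<close>

lemma riesz_representation:
  fixes f :: "'a::{real_inner,complete_space} \<Rightarrow> real"
  assumes "bounded_linear f"
  shows "\<exists>y. \<forall>x. f x = inner x y"
proof -
  interpret f: bounded_linear f by fact
  define J where "J x = (norm x)\<^sup>2 - 2 * f x" for x
  obtain B where B: "\<And>x. norm (f x) \<le> norm x * B"
    using f.bounded by blast
  \<comment> \<open>Completing the square: \<open>J x\<close> is at least the square of
    \<open>norm x - B\<close> minus the square of \<open>B\<close>.\<close>
  have lower: "J x \<ge> - B\<^sup>2" for x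
  proof -
    have "0 \<le> (norm x - B)\<^sup>2" by simp
    moreover have "f x \<le> norm x * B" using B[of x] by simp
    ultimately show ?thesis by (simp add: J_def power2_eq_square algebra_simps)
  qed
  define m where "m = Inf (range J)"
  have bdd: "bdd_below (range J)"
    using lower by (meson bdd_below.I2)
  have m_le: "m \<le> J x" for x
    unfolding m_def by (rule cInf_lower) (auto intro: bdd)
  have "\<exists>x. J x < m + inverse (real (Suc n))" for n
    using cInf_lessD[of "range J" "m + inverse (real (Suc n))"] unfolding m_def by force
  then obtain X where X: "\<And>n. J (X n) < m + inverse (real (Suc n))"
    by metis
  \<comment> \<open>The midpoint of \<open>x\<close> and \<open>y\<close> also has \<open>J\<close>
    at least \<open>m\<close>; the parallelogram law turns this into a bound on their
    distance.\<close>
  have par: "(norm (x - y))\<^sup>2 \<le> 2 * (J x - m) + 2 * (J y - m)" for x y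
  proof -
    have "m \<le> J ((1/2) *\<^sub>R (x + y))" by (rule m_le)
    also have "\<dots> = (norm (x + y))\<^sup>2 / 4 - (f x + f y)"
      by (simp add: J_def f.scaleR f.add power_divide) argo
    finally show ?thesis
      using norm_parallelogram[of x y] by (simp add: J_def)
  qed
  have "Cauchy X"
  proof (rule metric_CauchyI)
    fix r :: real assume "r > 0"
    then obtain n where n: "inverse (real (Suc n)) < r\<^sup>2 / 4"
      using reals_Archimedean[of "r\<^sup>2 / 4"] by auto
    have close: "J (X k) - m < r\<^sup>2 / 4" if "k \<ge> n" for k
    proof -
      have "inverse (real (Suc k)) \<le> inverse (real (Suc n))"
        using that by (simp add: divide_simps)
      then show ?thesis using X[of k] n by linarith
    qed
    have "dist (X k) (X l) < r" if "k \<ge> n" "l \<ge> n" for k l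
    proof -
      have "(norm (X k - X l))\<^sup>2 < r\<^sup>2"
        using par[of "X k" "X l"] close[OF that(1)] close[OF that(2)] by argo
      then show ?thesis
        using \<open>r > 0\<close> by (simp add: dist_norm power_less_imp_less_base)
    qed
    then show "\<exists>n. \<forall>k\<ge>n. \<forall>l\<ge>n. dist (X k) (X l) < r" by blast
  qed
  then obtain y where y: "X \<longlonglongrightarrow> y"
    by (auto simp: Cauchy_convergent_iff convergent_def)
  have "(\<lambda>n. J (X n)) \<longlonglongrightarrow> J y"
    unfolding J_def by (intro tendsto_intros f.tendsto y)
  moreover have "(\<lambda>n. m + inverse (real (Suc n))) \<longlonglongrightarrow> m + 0"
    by (intro tendsto_intros LIMSEQ_inverse_real_of_nat)
  ultimately have "J y \<le> m + 0"
    by (rule LIMSEQ_le) (use X less_imp_le in blast)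
  then have min: "J y \<le> J x" for x
    using m_le[of x] by linarith
  have "f z = inner z y" for z
  proof (rule ccontr)
    define d where "d = f z - inner z y"
    assume "f z \<noteq> inner z y"
    then have "d \<noteq> 0" by (simp add: d_def)
    \<comment> \<open>First variation: moving \<open>y\<close> by \<open>t\<close> along
      \<open>z\<close> cannot lower \<open>J\<close>.\<close>
    have nonneg: "0 \<le> t\<^sup>2 * (norm z)\<^sup>2 - 2 * t * d" for t
    proof -
      have "(norm (y + t *\<^sub>R z))\<^sup>2 = (norm y)\<^sup>2 + 2 * (t * inner z y) + t\<^sup>2 * (norm z)\<^sup>2"
        unfolding power2_norm_eq_inner
        by (simp add: inner_simps inner_commute power2_eq_square)
      then show ?thesis
        using min[of "y + t *\<^sub>R z"] by (simp add: J_def d_def f.add f.scaleR algebra_simps)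
    qed
    \<comment> \<open>The \<open>+ 1\<close> makes \<open>s\<close> positive for every
      \<open>z\<close>. At \<open>t = d / s\<close> the linear term outweighs the quadratic one, so
      the expression is negative.\<close>
    define s where "s = (norm z)\<^sup>2 + 1"
    have "s > 0" by (simp add: s_def add_nonneg_pos)
    have "0 \<le> (d / s)\<^sup>2 * (norm z)\<^sup>2 - 2 * (d / s) * d" by (rule nonneg)
    also have "\<dots> = d\<^sup>2 / s\<^sup>2 * ((norm z)\<^sup>2 - 2 * s)"
      using \<open>s > 0\<close> by (simp add: field_simps power2_eq_square)
    finally have "0 \<le> d\<^sup>2 / s\<^sup>2 * ((norm z)\<^sup>2 - 2 * s)" .
    moreover have "0 < d\<^sup>2 / s\<^sup>2"
      using \<open>s > 0\<close> \<open>d \<noteq> 0\<close> by simp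
    ultimately have "0 \<le> (norm z)\<^sup>2 - 2 * s"
      by (simp only: zero_le_mult_iff) linarith
    then show False
      using zero_le_power2[of "norm z"] unfolding s_def by argo
  qed
  then show ?thesis by blast
qed

text \<open>The Riesz theorem is real and matches only real parts; using it at
  \<open>\<i> *\<^sub>C x\<close> matches the imaginary parts as well. Uniqueness has to be shown
  too, since \<open>cadjoint\<close> is a definite description.\<close>

lemma cinner_cadjoint:
  assumes "bounded_clinear (A :: 'k::complex_hilbert \<Rightarrow> 'k)"
  shows "cinner (A x) y = cinner x (cadjoint A y)"
proof -
  have A: "bounded_linear A" and AC: "\<And>a x. A (a *\<^sub>C x) = a *\<^sub>C A x"
    using assms by (auto simp: bounded_clinear_def)
  have "\<exists>z. \<forall>x. inner (A x) y = inner x z" for y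
    by (intro riesz_representation bounded_linear_compose[OF bounded_linear_inner_left A])
  then obtain B where B: "\<And>x y. inner (A x) y = inner x (B y)" by metis
  have eq: "cinner (A x) y = cinner x (B y)" for x y
  proof (rule complex_eqI)
    show "Re (cinner (A x) y) = Re (cinner x (B y))"
      using B[of x y] by (simp add: inner_eq_Re_cinner)
    show "Im (cinner (A x) y) = Im (cinner x (B y))"
      using B[of "\<i> *\<^sub>C x" y] by (simp add: inner_eq_Re_cinner AC cinner_scaleC_left)
  qed
  have "\<forall>x y. cinner (A x) y = cinner x (cadjoint A y)"
    unfolding cadjoint_def
  proof (rule theI[of _ B])
    show "\<forall>x y. cinner (A x) y = cinner x (B y)" using eq by blast
    fix B' assume B': "\<forall>x y. cinner (A x) y = cinner x (B' y)"
    show "B' = B"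
    proof
      fix y
      have "B' y - B y = 0"
        by (rule cinner_eq_0_all) (use B' eq in \<open>simp add: cinner_diff_right\<close>)
      then show "B' y = B y" by simp
    qed
  qed
  then show ?thesis by blast
qed

lemma cadjoint_add:
  assumes "bounded_clinear (A :: 'k::complex_hilbert \<Rightarrow> 'k)"
  shows "cadjoint A (x + y) = cadjoint A x + cadjoint A y"
proof -
  have "cadjoint A (x + y) - (cadjoint A x + cadjoint A y) = 0"
    by (rule cinner_eq_0_all)
      (simp add: cinner_diff_right cinner_add_right cinner_cadjoint[OF assms, symmetric])
  then show ?thesis by simp
qed

lemma cadjoint_scaleC:
  assumes "bounded_clinear (A :: 'k::complex_hilbert \<Rightarrow> 'k)"
  shows "cadjoint A (a *\<^sub>C x) = a *\<^sub>C cadjoint A x"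
proof -
  have "cadjoint A (a *\<^sub>C x) - (a *\<^sub>C cadjoint A x) = 0"
    by (rule cinner_eq_0_all)
      (simp add: cinner_diff_right cinner_scaleC_right cinner_cadjoint[OF assms, symmetric])
  then show ?thesis by simp
qed

section \<open>Words and the adjoint operators\<close>

definition words_of_length :: "nat \<Rightarrow> nat \<Rightarrow> nat list set"
  where "words_of_length N n = {w \<in> words N. length w = n}"

lemma finite_words_of_length [simp]: "finite (words_of_length N n)"
proof -
  have "words_of_length N n = {w. set w \<subseteq> {..<N} \<and> length w = n}"
    by (auto simp: words_of_length_def words_def in_lists_conv_set)
  then show ?thesis by (simp add: finite_lists_length_eq)
qed

lemma words_of_length_0 [simp]: "words_of_length N 0 = {[]}"
  by (auto simp: words_of_length_def words_def)

lemma words_simps [simp]: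
  "[] \<in> words N" "i # w \<in> words N \<longleftrightarrow> i < N \<and> w \<in> words N"
  "v @ w \<in> words N \<longleftrightarrow> v \<in> words N \<and> w \<in> words N"
  by (auto simp: words_def)

lemma sum_words_Cons:
  "(\<Sum>w\<in>words_of_length N (Suc n). f w) = (\<Sum>i<N. \<Sum>w\<in>words_of_length N n. f (i # w))"
proof -
  have "(\<Sum>w\<in>words_of_length N (Suc n). f w)
      = (\<Sum>(i, w)\<in>{..<N} \<times> words_of_length N n. f (i # w))"
    by (rule sum.reindex_bij_witness[of _ "\<lambda>(i, w). i # w" "\<lambda>w. (hd w, tl w)"])
      (auto simp: words_of_length_def length_Suc_conv)
  then show ?thesis by (simp add: sum.cartesian_product)
qed

lemma sum_words_snoc:
  "(\<Sum>w\<in>words_of_length N (Suc n). f w) = (\<Sum>w\<in>words_of_length N n. \<Sum>i<N. f (w @ [i]))"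
proof -
  have "(\<Sum>w\<in>words_of_length N (Suc n). f w)
      = (\<Sum>(w, i)\<in>words_of_length N n \<times> {..<N}. f (w @ [i]))"
    by (rule sum.reindex_bij_witness[of _ "\<lambda>(w, i). w @ [i]" "\<lambda>w. (butlast w, last w)"])
      (auto simp: words_of_length_def length_Suc_conv_rev)
  then show ?thesis by (simp add: sum.cartesian_product)
qed

lemma word_map_append [simp]: "word_map g (v @ w) t = word_map g w (word_map g v t)"
  by (induction v arbitrary: t) auto

lemma word_coeff_append [simp]:
  "word_coeff g \<nu> (v @ w) t = word_coeff g \<nu> v t * word_coeff g \<nu> w (word_map g v t)"
  by (induction v arbitrary: t) auto

lemma invariant_set_word_map:
  assumes "invariant_set N g \<nu> M" "w \<in> words N" "t \<in> M" "word_coeff g \<nu> w t \<noteq> 0"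
  shows "word_map g w t \<in> M"
  using assms(2-) by (induction w arbitrary: t) (use assms(1) in \<open>auto simp: invariant_set_def\<close>)

text \<open>If \<open>b\<close> returns to \<open>c\<close> before its end, cutting there leaves a
  shorter suffix that again returns to \<open>c\<close> with nonzero coefficient; repeating this
  ends in a cycle word. This links cycle words with \<open>fresh\<close>, which speaks of arbitrary
  returns.\<close>

lemma final_cycle_iff:
  assumes "w \<in> words N"
  shows "(\<exists>a b. w = a @ b \<and> cycle_word N g \<nu> c b) \<longleftrightarrow>
    (\<exists>a b. w = a @ b \<and> b \<noteq> [] \<and> word_map g b c = c \<and> word_coeff g \<nu> b c \<noteq> 0)"
proof
  assume "\<exists>a b. w = a @ b \<and> b \<noteq> [] \<and> word_map g b c = c \<and> word_coeff g \<nu> b c \<noteq> 0"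
  then obtain a b where "w = a @ b" "b \<noteq> []" "word_map g b c = c" "word_coeff g \<nu> b c \<noteq> 0"
    by blast
  then show "\<exists>a b. w = a @ b \<and> cycle_word N g \<nu> c b"
  proof (induction "length b" arbitrary: a b rule: less_induct)
    case less
    show ?case
    proof (cases "\<exists>k. 0 < k \<and> k < length b \<and> word_map g (take k b) c = c")
      case True
      then obtain k where k: "0 < k" "k < length b" "word_map g (take k b) c = c" by blast
      have "word_map g (take k b @ drop k b) c = c" "word_coeff g \<nu> (take k b @ drop k b) c \<noteq> 0"
        using less.prems by simp_all
      then have "word_map g (drop k b) c = c" "word_coeff g \<nu> (drop k b) c \<noteq> 0"
        unfolding word_map_append word_coeff_append k(3) by auto
      moreover have "w = (a @ take k b) @ drop k b" "drop k b \<noteq> []" "length (drop k b) < length b"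
        using less.prems k by auto
      ultimately show ?thesis using less.hyps by blast
    next
      case False
      then have "cycle_word N g \<nu> c b"
        using less.prems assms by (auto simp: cycle_word_def)
      then show ?thesis using less.prems by blast
    qed
  qed
qed (auto simp: cycle_word_def)

locale row_walk =
  fixes N :: nat and V :: "nat \<Rightarrow> 'k::complex_hilbert \<Rightarrow> 'k"
    and e :: "'t \<Rightarrow> 'k" and g :: "nat \<Rightarrow> 't \<Rightarrow> 't" and \<nu> :: "nat \<Rightarrow> 't \<Rightarrow> complex"
  assumes row: "row_coisometry N V"
    and norm_e [simp]: "norm (e t) = 1"
    and adj_e: "i < N \<Longrightarrow> cadjoint (V i) (e t) = \<nu> i t *\<^sub>C e (g i t)"
begin

abbreviation W :: "nat \<Rightarrow> 'k \<Rightarrow> 'k" where "W i \<equiv> cadjoint (V i)"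

lemma V_bounded: "i < N \<Longrightarrow> bounded_clinear (V i)"
  using row by (simp add: row_coisometry_def)

lemma cinner_e_self [simp]: "cinner (e t) (e t) = 1"
  by (simp add: cinner_self)

text \<open>The co-isometry relation says that sending \<open>x\<close> to the tuple of all
  \<open>W i x\<close> is isometric; iterated, it yields the same for the words of each
  length.\<close>

lemma cinner_W_sum: "(\<Sum>i<N. cinner (W i x) (W i y)) = cinner x y"
proof -
  have "(\<Sum>i<N. cinner (W i x) (W i y)) = cinner (\<Sum>i<N. V i (W i x)) y"
    unfolding cinner_sum_left by (intro sum.cong refl) (simp add: cinner_cadjoint V_bounded)
  then show ?thesis using row by (simp add: row_coisometry_def)
qed

lemma norm_W_sum: "(\<Sum>i<N. (norm (W i x))\<^sup>2) = (norm x)\<^sup>2"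
proof -
  have "complex_of_real (\<Sum>i<N. (norm (W i x))\<^sup>2) = complex_of_real ((norm x)\<^sup>2)"
    unfolding of_real_sum cinner_self[symmetric] by (rule cinner_W_sum)
  then show ?thesis by (simp only: of_real_eq_iff)
qed

lemma norm_W_le: "i < N \<Longrightarrow> norm (W i x) \<le> norm x"
proof -
  assume "i < N"
  then have "(norm (W i x))\<^sup>2 \<le> (\<Sum>i<N. (norm (W i x))\<^sup>2)"
    by (intro member_le_sum) auto
  then show ?thesis
    unfolding norm_W_sum by (simp add: power2_le_iff_abs_le)
qed

text \<open>This makes the squared moduli transition probabilities; both the conservation of mass
  and the minimum principle rest on it.\<close>

lemma nu_sum: "(\<Sum>i<N. (cmod (\<nu> i t))\<^sup>2) = 1"
  using norm_W_sum[of "e t"] by (simp add: adj_e norm_scaleC)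

lemma continuous_W: "i < N \<Longrightarrow> continuous_on A (W i)"
proof -
  assume i: "i < N"
  have "W i (x - y) = W i x - W i y" for x y
    using cadjoint_add[OF V_bounded[OF i], of "x - y" y] by (simp add: algebra_simps)
  then have "dist (W i x) (W i y) \<le> dist x y" for x y
    using norm_W_le[OF i, of "x - y"] by (simp add: dist_norm)
  then show ?thesis
    unfolding continuous_on_iff by (meson le_less_trans)
qed

lemma word_W_add: "w \<in> words N \<Longrightarrow> word_map W w (x + y) = word_map W w x + word_map W w y"
  by (induction w arbitrary: x y) (auto simp: cadjoint_add V_bounded)

lemma word_W_diff: "w \<in> words N \<Longrightarrow> word_map W w (x - y) = word_map W w x - word_map W w y"
  using word_W_add[of w "x - y" y] by (simp add: algebra_simps)

lemma word_W_scaleC: "w \<in> words N \<Longrightarrow> word_map W w (a *\<^sub>C x) = a *\<^sub>C word_map W w x"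
  by (induction w arbitrary: x) (auto simp: cadjoint_scaleC V_bounded)

lemma word_W_e: "w \<in> words N \<Longrightarrow> word_map W w (e t) = word_coeff g \<nu> w t *\<^sub>C e (word_map g w t)"
  by (induction w arbitrary: t)
    (auto simp: adj_e word_W_scaleC scaleC_scaleC)

text \<open>\<open>word_map W w\<close> applies the adjoints in reading order, which is the order in
  the adjoint of the left-to-right product \<open>word_op V w\<close>. Frame coefficients thus
  become coefficients of \<open>word_map W w v\<close>.\<close>

lemma word_op_adjoint: "w \<in> words N \<Longrightarrow> cinner v (word_op V w x) = cinner (word_map W w v) x"
proof (induction w arbitrary: v)
  case (Cons i w)
  then have "cinner v (V i y) = cinner (W i v) y" for y
    by (metis V_bounded cinner_cadjoint cinner_commute words_simps(2))
  with Cons show ?case by simp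
qed simp

lemma cinner_words_sum: "(\<Sum>w\<in>words_of_length N n. cinner (word_map W w x) (word_map W w y)) = cinner x y"
  by (induction n arbitrary: x y) (simp_all add: sum_words_Cons cinner_W_sum)

lemma norm_words_sum: "(\<Sum>w\<in>words_of_length N n. (norm (word_map W w x))\<^sup>2) = (norm x)\<^sup>2"
  by (induction n arbitrary: x) (simp_all add: sum_words_Cons norm_W_sum)

end

section \<open>Transport of mass on a finite invariant set\<close>

locale finite_walk = row_walk N V e g \<nu>
  for N and V :: "nat \<Rightarrow> 'k::complex_hilbert \<Rightarrow> 'k" and e :: "'t \<Rightarrow> 'k" and g \<nu> +
  fixes M :: "'t set"
  assumes finite_M: "finite M"
    and inv_M: "invariant_set N g \<nu> M"
    and orth: "\<lbrakk>s \<in> M; t \<in> M\<rbrakk> \<Longrightarrow> cinner (e s) (e t) = (if s = t then 1 else 0)"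
    and inj_g: "i < N \<Longrightarrow> inj (g i)"
    and reversing: "reversing_on N V M e g \<nu>"
begin

abbreviation mass :: "'k \<Rightarrow> 't \<Rightarrow> real" where "mass x d \<equiv> (cmod (cinner x (e d)))\<^sup>2"

text \<open>For the tuple of all \<open>word_map W w v\<close> with \<open>w\<close> of length
  \<open>n\<close>, this is the squared norm of its componentwise projection onto the span of the
  \<open>e d\<close> with \<open>d \<in> M\<close>.\<close>

definition level_mass :: "nat \<Rightarrow> 'k \<Rightarrow> real"
  where "level_mass n v = (\<Sum>w\<in>words_of_length N n. \<Sum>d\<in>M. mass (word_map W w v) d)"

lemma level_mass_Suc: "level_mass (Suc n) v = (\<Sum>i<N. level_mass n (W i v))"
  by (simp add: level_mass_def sum_words_Cons)

lemma level_mass_nonneg: "0 \<le> level_mass n v"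
  unfolding level_mass_def by (intro sum_nonneg) simp

lemma level_mass_le: "level_mass n v \<le> (norm v)\<^sup>2"
  unfolding level_mass_def norm_words_sum[of v n, symmetric]
  by (intro sum_mono bessel finite_M orth)

text \<open>Reversibility enters here: moving \<open>W i\<close> to the other side produces
  \<open>V i (e (g i s))\<close>, a multiple of \<open>e s\<close>.\<close>

lemma mass_W:
  assumes "i < N" "s \<in> M" "\<nu> i s \<noteq> 0"
  shows "mass (W i x) (g i s) = (cmod (\<nu> i s))\<^sup>2 * mass x s"
proof -
  have "cinner (W i x) (e (g i s)) = cinner x (V i (e (g i s)))"
    by (metis V_bounded assms(1) cinner_cadjoint cinner_commute)
  also have "\<dots> = \<nu> i s * cinner x (e s)"
    using reversing assms by (simp add: reversing_on_def cinner_scaleC_right)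
  finally show ?thesis by (simp add: norm_mult power_mult_distrib)
qed

text \<open>Such points have no parent in \<open>M\<close> under the letter \<open>i\<close>, so
  mass found on them after \<open>W i\<close> was not transported from \<open>M\<close>; it accounts
  for the growth of \<open>level_mass\<close>.\<close>

definition new_points :: "nat \<Rightarrow> 't set"
  where "new_points i = {d \<in> M. \<forall>s\<in>M. \<nu> i s \<noteq> 0 \<longrightarrow> g i s \<noteq> d}"

definition new_mass :: "'k \<Rightarrow> real"
  where "new_mass x = (\<Sum>i<N. \<Sum>d\<in>new_points i. mass (W i x) d)"

lemma new_mass_nonneg: "0 \<le> new_mass x"
  unfolding new_mass_def by (intro sum_nonneg) simp

text \<open>By injectivity a point of the index set either has a single parent, lying in
  \<open>A\<close>, or is a new point, for which the condition is vacuous. Mass passes to children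
  by \<open>mass_W\<close>, and the factors add up to \<open>1\<close> over \<open>i\<close>. First
  visits use this with marked points removed from \<open>A\<close>.\<close>

lemma mass_step:
  assumes "A \<subseteq> M"
  shows "(\<Sum>i<N. \<Sum>d\<in>{d \<in> M. \<forall>s\<in>M. \<nu> i s \<noteq> 0 \<and> g i s = d \<longrightarrow> s \<in> A}. mass (W i x) d)
    = (\<Sum>s\<in>A. mass x s) + new_mass x"
proof -
  have fin: "finite A" using assms finite_M finite_subset by blast
  have "(\<Sum>d\<in>{d \<in> M. \<forall>s\<in>M. \<nu> i s \<noteq> 0 \<and> g i s = d \<longrightarrow> s \<in> A}. mass (W i x) d)
      = (\<Sum>s\<in>A. (cmod (\<nu> i s))\<^sup>2 * mass x s) + (\<Sum>d\<in>new_points i. mass (W i x) d)"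
    if i: "i < N" for i
  proof -
    let ?A = "{s \<in> A. \<nu> i s \<noteq> 0}"
    have "{d \<in> M. \<forall>s\<in>M. \<nu> i s \<noteq> 0 \<and> g i s = d \<longrightarrow> s \<in> A} = g i ` ?A \<union> new_points i"
      using inv_M i assms inj_g[OF i] by (auto simp: new_points_def invariant_set_def dest: injD)
    moreover have "g i ` ?A \<inter> new_points i = {}"
      using assms by (auto simp: new_points_def)
    moreover have "finite (new_points i)"
      using finite_M by (simp add: new_points_def)
    moreover have "(\<Sum>d\<in>g i ` ?A. mass (W i x) d) = (\<Sum>s\<in>?A. (cmod (\<nu> i s))\<^sup>2 * mass x s)"
      using inj_g[OF i] assms i
      by (subst sum.reindex) (auto intro!: sum.cong mass_W intro: inj_on_subset)
    moreover have "(\<Sum>s\<in>?A. (cmod (\<nu> i s))\<^sup>2 * mass x s) = (\<Sum>s\<in>A. (cmod (\<nu> i s))\<^sup>2 * mass x s)"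
      using fin by (intro sum.mono_neutral_left) auto
    ultimately show ?thesis
      using fin by (simp add: sum.union_disjoint)
  qed
  then have "(\<Sum>i<N. \<Sum>d\<in>{d \<in> M. \<forall>s\<in>M. \<nu> i s \<noteq> 0 \<and> g i s = d \<longrightarrow> s \<in> A}. mass (W i x) d)
    = (\<Sum>i<N. \<Sum>s\<in>A. (cmod (\<nu> i s))\<^sup>2 * mass x s) + new_mass x"
    by (simp add: new_mass_def sum.distrib)
  also have "(\<Sum>i<N. \<Sum>s\<in>A. (cmod (\<nu> i s))\<^sup>2 * mass x s) = (\<Sum>s\<in>A. mass x s)"
    by (subst sum.swap) (simp add: sum_distrib_right[symmetric] nu_sum)
  finally show ?thesis .
qed

lemma level_mass_step: "level_mass (Suc n) v = level_mass n v + (\<Sum>w\<in>words_of_length N n. new_mass (word_map W w v))"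
proof -
  have "(\<Sum>i<N. \<Sum>d\<in>M. mass (W i x) d) = (\<Sum>s\<in>M. mass x s) + new_mass x" for x
    using mass_step[of M x] by simp
  then show ?thesis
    by (simp add: level_mass_def sum_words_snoc sum.distrib)
qed

lemma incseq_level_mass: "incseq (\<lambda>n. level_mass n v)"
  by (intro incseq_SucI) (simp add: level_mass_step sum_nonneg new_mass_nonneg)

section \<open>The limit of the level masses as a continuous quadratic form\<close>

definition limit_mass :: "'k \<Rightarrow> real" where "limit_mass v = lim (\<lambda>n. level_mass n v)"

lemma level_mass_tendsto: "(\<lambda>n. level_mass n v) \<longlonglongrightarrow> limit_mass v"
proof -
  have "Bseq (\<lambda>n. level_mass n v)"
    using level_mass_le level_mass_nonneg by (intro BseqI'[of _ "(norm v)\<^sup>2"]) simp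
  then have "convergent (\<lambda>n. level_mass n v)"
    using incseq_level_mass Bseq_monoseq_convergent monoseq_iff by blast
  then show ?thesis unfolding limit_mass_def by (simp add: convergent_LIMSEQ_iff)
qed

lemma level_mass_le_limit_mass: "level_mass n v \<le> limit_mass v"
  using incseq_le[OF incseq_level_mass level_mass_tendsto] .

lemma limit_mass_le: "limit_mass v \<le> (norm v)\<^sup>2"
  using LIMSEQ_le_const2[OF level_mass_tendsto] level_mass_le by blast

lemma limit_mass_nonneg: "0 \<le> limit_mass v"
  using level_mass_le_limit_mass level_mass_nonneg order_trans by blast

text \<open>Here the first letter is split off, whereas monotonicity in \<open>n\<close> came from
  splitting off the last.\<close>

lemma limit_mass_harmonic: "limit_mass v = (\<Sum>i<N. limit_mass (W i v))"
proof (rule LIMSEQ_unique)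
  show "(\<lambda>n. level_mass (Suc n) v) \<longlonglongrightarrow> limit_mass v"
    using level_mass_tendsto by (rule LIMSEQ_Suc)
  show "(\<lambda>n. level_mass (Suc n) v) \<longlonglongrightarrow> (\<Sum>i<N. limit_mass (W i v))"
    unfolding level_mass_Suc by (intro tendsto_sum level_mass_tendsto)
qed

lemma limit_mass_scaleC: "limit_mass (a *\<^sub>C v) = (cmod a)\<^sup>2 * limit_mass v"
proof -
  have "level_mass n (a *\<^sub>C v) = (cmod a)\<^sup>2 * level_mass n v" for n
    unfolding level_mass_def sum_distrib_left
    by (intro sum.cong refl)
      (simp add: word_W_scaleC words_of_length_def cinner_scaleC_left norm_mult power_mult_distrib)
  then have "(\<lambda>n. level_mass n (a *\<^sub>C v)) \<longlonglongrightarrow> (cmod a)\<^sup>2 * limit_mass v"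
    using tendsto_mult_left[OF level_mass_tendsto] by simp
  then show ?thesis using level_mass_tendsto LIMSEQ_unique by blast
qed

lemma limit_mass_parallelogram: "limit_mass (x + y) + limit_mass (x - y) = 2 * limit_mass x + 2 * limit_mass y"
proof -
  have "level_mass n (x + y) + level_mass n (x - y) = 2 * level_mass n x + 2 * level_mass n y" for n
    unfolding level_mass_def sum_distrib_left sum.distrib[symmetric]
    by (intro sum.cong refl)
      (simp add: word_W_add word_W_diff words_of_length_def cinner_add_left cinner_diff_left
        norm_parallelogram)
  moreover have "(\<lambda>n. level_mass n (x + y) + level_mass n (x - y)) \<longlonglongrightarrow> limit_mass (x + y) + limit_mass (x - y)"
    "(\<lambda>n. 2 * level_mass n x + 2 * level_mass n y) \<longlonglongrightarrow> 2 * limit_mass x + 2 * limit_mass y"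
    by (intro tendsto_intros level_mass_tendsto)+
  ultimately show ?thesis using LIMSEQ_unique by simp
qed

text \<open>The square root of the level mass is the Euclidean norm of finitely many coefficients
  that are linear in the vector, so Minkowski's inequality applies.\<close>

lemma sqrt_level_mass_triangle: "sqrt (level_mass n (x + y)) \<le> sqrt (level_mass n x) + sqrt (level_mass n y)"
proof -
  let ?I = "words_of_length N n \<times> M"
  let ?f = "\<lambda>x (w, d). cmod (cinner (word_map W w x) (e d))"
  have L2: "sqrt (level_mass n x) = L2_set (?f x) ?I" for x
    by (simp add: level_mass_def L2_set_def sum.cartesian_product case_prod_unfold)
  have "L2_set (?f (x + y)) ?I \<le> L2_set (\<lambda>p. ?f x p + ?f y p) ?I"
    by (rule L2_set_mono)
      (auto simp: words_of_length_def word_W_add cinner_add_left norm_triangle_ineq)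
  also have "\<dots> \<le> L2_set (?f x) ?I + L2_set (?f y) ?I"
    by (rule L2_set_triangle_ineq)
  finally show ?thesis unfolding L2 .
qed

text \<open>The triangle inequality and the bound by the norm pass to the limit. The resulting
  continuity is needed both for closures of spans and, composed with \<open>e\<close>, for the
  minimum principle.\<close>

lemma sqrt_limit_mass_lipschitz: "\<bar>sqrt (limit_mass x) - sqrt (limit_mass y)\<bar> \<le> norm (x - y)"
proof -
  have *: "sqrt (limit_mass x) \<le> sqrt (limit_mass y) + norm (x - y)" for x y
  proof (rule LIMSEQ_le)
    show "(\<lambda>n. sqrt (level_mass n x)) \<longlonglongrightarrow> sqrt (limit_mass x)"
      "(\<lambda>n. sqrt (level_mass n y) + norm (x - y)) \<longlonglongrightarrow> sqrt (limit_mass y) + norm (x - y)"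
      by (intro tendsto_intros level_mass_tendsto)+
    have "sqrt (level_mass n (x - y)) \<le> norm (x - y)" for n
      using level_mass_le real_le_lsqrt[OF norm_ge_zero] by blast
    then have "sqrt (level_mass n x) \<le> sqrt (level_mass n y) + norm (x - y)" for n
      using sqrt_level_mass_triangle[of n y "x - y"] by (smt (verit) add_diff_cancel_left' add.commute diff_add_cancel)
    then show "\<exists>k. \<forall>n\<ge>k. sqrt (level_mass n x) \<le> sqrt (level_mass n y) + norm (x - y)" by blast
  qed
  show ?thesis
    using *[of x y] *[of y x] by (simp add: norm_minus_commute)
qed

lemma continuous_limit_mass: "continuous_on A limit_mass"
proof -
  have "continuous_on A (\<lambda>x. sqrt (limit_mass x))"
    unfolding continuous_on_iff dist_norm real_norm_def
    by (meson sqrt_limit_mass_lipschitz le_less_trans)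
  then have "continuous_on A (\<lambda>x. (sqrt (limit_mass x))\<^sup>2)"
    by (rule continuous_on_power)
  moreover have "(\<lambda>x. (sqrt (limit_mass x))\<^sup>2) = limit_mass"
    by (intro ext real_sqrt_pow2 limit_mass_nonneg)
  ultimately show ?thesis by (simp only:)
qed

text \<open>The empty word alone contributes mass \<open>1\<close>, which is also the largest value
  the norm allows.\<close>

lemma limit_mass_e_M: "t \<in> M \<Longrightarrow> limit_mass (e t) = 1"
proof -
  assume t: "t \<in> M"
  have "level_mass 0 (e t) = (\<Sum>d\<in>M. if t = d then 1 else 0)"
    unfolding level_mass_def by (simp, intro sum.cong refl) (simp add: orth t)
  then have "level_mass 0 (e t) = 1"
    using finite_M t by simp
  then show ?thesis
    using level_mass_le_limit_mass[of 0 "e t"] limit_mass_le[of "e t"] by simp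
qed

lemma limit_mass_e_harmonic: "limit_mass (e t) = (\<Sum>i<N. (cmod (\<nu> i t))\<^sup>2 * limit_mass (e (g i t)))"
  by (subst limit_mass_harmonic) (simp add: adj_e limit_mass_scaleC)

text \<open>The defect \<open>\<parallel>v\<parallel>\<^sup>2 - limit_mass v\<close> is nonnegative and satisfies the parallelogram law, so its zeros
  form a subspace.\<close>

lemma limit_mass_eq_norm:
  assumes "\<And>t. limit_mass (e t) = 1" and dense: "closed_cspan (range e) = UNIV"
  shows "limit_mass v = (norm v)\<^sup>2"
proof -
  let ?Z = "{v. limit_mass v = (norm v)\<^sup>2}"
  have "complex_vector.subspace ?Z"
  proof (rule complex_vector.subspaceI)
    show "0 \<in> ?Z" using limit_mass_le[of 0] limit_mass_nonneg[of 0] by simp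
  next
    fix x y assume "x \<in> ?Z" "y \<in> ?Z"
    \<comment> \<open>The defects of \<open>x + y\<close> and \<open>x - y\<close> are nonnegative
      and add up to \<open>0\<close>, so both vanish.\<close>
    then show "x + y \<in> ?Z"
      using limit_mass_parallelogram[of x y] norm_parallelogram[of x y] limit_mass_le[of "x + y"] limit_mass_le[of "x - y"]
      by simp
  next
    fix a x assume "x \<in> ?Z"
    then show "a *\<^sub>C x \<in> ?Z"
      by (simp add: limit_mass_scaleC norm_scaleC power_mult_distrib)
  qed
  then have "complex_vector.span (range e) \<subseteq> ?Z"
    using assms(1) by (intro complex_vector.span_minimal) auto
  moreover have "closed ?Z"
    by (intro closed_Collect_eq continuous_limit_mass continuous_intros)
  ultimately have "closed_cspan (range e) \<subseteq> ?Z"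
    unfolding closed_cspan_def by (rule closure_minimal)
  then show ?thesis using dense by auto
qed

end

section \<open>First visits\<close>

text \<open>\<open>C\<close> stands for the chosen points, one in each minimal set: every point of
  \<open>M\<close> leads to \<open>C\<close>, and a possible walk from \<open>C\<close> to
  \<open>C\<close> ends where it began.\<close>

locale marked_walk = finite_walk N V e g \<nu> M
  for N and V :: "nat \<Rightarrow> 'k::complex_hilbert \<Rightarrow> 'k" and e :: "'t \<Rightarrow> 'k" and g \<nu> M +
  fixes C :: "'t set"
  assumes C_subset: "C \<subseteq> M"
    and C_reached: "s \<in> M \<Longrightarrow> \<exists>w\<in>words N. word_map g w s \<in> C \<and> word_coeff g \<nu> w s \<noteq> 0"
    and C_isolated: "\<lbrakk>c \<in> C; w \<in> words N; word_coeff g \<nu> w c \<noteq> 0; word_map g w c \<in> C\<rbrakk>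
      \<Longrightarrow> word_map g w c = c"
begin

text \<open>When the letters of \<open>w\<close> are read one by one, the mass of \<open>\<langle>W\<^sub>w v, e\<^sub>d\<rangle>\<close> descends from the unique
  parent of \<open>d\<close>, if there is one; \<open>fresh w\<close> are the points none of whose proper ancestors lies in
  \<open>C\<close>.\<close>

definition fresh :: "nat list \<Rightarrow> 't set"
  where "fresh w = {d \<in> M. \<not> (\<exists>a b. w = a @ b \<and> b \<noteq> [] \<and>
    (\<exists>s\<in>C. word_coeff g \<nu> b s \<noteq> 0 \<and> word_map g b s = d))}"

lemma fresh_subset: "fresh w \<subseteq> M"
  by (auto simp: fresh_def)

lemma fresh_Nil [simp]: "fresh [] = M"
  by (auto simp: fresh_def)

text \<open>Freshness is inherited letter by letter. The condition on parents is the one in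
  \<open>mass_step\<close> with \<open>A = fresh w - C\<close>.\<close>

lemma fresh_snoc:
  assumes w: "w \<in> words N" and i: "i < N"
  shows "fresh (w @ [i]) = {d \<in> M. \<forall>s\<in>M. \<nu> i s \<noteq> 0 \<and> g i s = d \<longrightarrow> s \<in> fresh w - C}"
proof (intro set_eqI iffI)
  fix d assume d: "d \<in> fresh (w @ [i])"
  have "s \<in> fresh w - C" if s: "s \<in> M" "\<nu> i s \<noteq> 0" "g i s = d" for s
  proof -
    have "s \<notin> C"
      using d s unfolding fresh_def by (fastforce dest: spec[of _ w] spec[of _ "[i]"])
    moreover have "s \<in> fresh w"
    proof (rule ccontr)
      assume "s \<notin> fresh w"
      then obtain a b c where abc: "w = a @ b" "b \<noteq> []" "c \<in> C" "word_coeff g \<nu> b c \<noteq> 0" "word_map g b c = s"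
        using s(1) by (auto simp: fresh_def)
      then have "w @ [i] = a @ (b @ [i])" "b @ [i] \<noteq> []"
        "word_coeff g \<nu> (b @ [i]) c \<noteq> 0" "word_map g (b @ [i]) c = d"
        using s by auto
      then show False using d abc(3) unfolding fresh_def by blast
    qed
    ultimately show ?thesis by blast
  qed
  then show "d \<in> {d \<in> M. \<forall>s\<in>M. \<nu> i s \<noteq> 0 \<and> g i s = d \<longrightarrow> s \<in> fresh w - C}"
    using d fresh_subset by blast
next
  fix d assume d: "d \<in> {d \<in> M. \<forall>s\<in>M. \<nu> i s \<noteq> 0 \<and> g i s = d \<longrightarrow> s \<in> fresh w - C}"
  have False if ab: "w @ [i] = a @ b" "b \<noteq> []" and c: "c \<in> C" "word_coeff g \<nu> b c \<noteq> 0" "word_map g b c = d" for a b c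
  proof -
    obtain b' where b': "b = b' @ [i]" "w = a @ b'"
      using ab by (metis append_butlast_last_id append.assoc butlast_append butlast_snoc last_appendR last_snoc)
    define s where "s = word_map g b' c"
    have nz: "word_coeff g \<nu> b' c \<noteq> 0" "\<nu> i s \<noteq> 0" "g i s = d"
      using c b' by (auto simp: s_def)
    moreover have "s \<in> M"
      using invariant_set_word_map[OF inv_M _ _ nz(1)] w b' c(1) C_subset by (auto simp: s_def)
    ultimately have s: "s \<in> fresh w" "s \<notin> C"
      using d by auto
    \<comment> \<open>With \<open>b'\<close> empty, \<open>s\<close> would be \<open>c\<close>
      itself, a point of \<open>C\<close>.\<close>
    then have "b' \<noteq> []" using c(1) by (auto simp: s_def)
    then show False
      using s(1) b' c(1) nz(1) unfolding fresh_def s_def by blast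
  qed
  then show "d \<in> fresh (w @ [i])"
    using d unfolding fresh_def by blast
qed

text \<open>By \<open>C_isolated\<close> a marked ancestor of \<open>c\<close> can only be
  \<open>c\<close> itself, so being fresh means that no nonempty suffix of \<open>w\<close> is a
  possible return to \<open>c\<close>; \<open>final_cycle_iff\<close> brings in the cycle
  words.\<close>

lemma C_fresh_iff:
  assumes c: "c \<in> C" and w: "w \<in> words N"
  shows "c \<in> fresh w \<longleftrightarrow> w \<in> words_no_final_cycle N g \<nu> c"
proof -
  have "c \<in> fresh w \<longleftrightarrow> \<not> (\<exists>a b. w = a @ b \<and> b \<noteq> [] \<and> word_map g b c = c \<and> word_coeff g \<nu> b c \<noteq> 0)"
  proof -
    have "s = c" if "s \<in> C" "w = a @ b" "word_coeff g \<nu> b s \<noteq> 0" "word_map g b s = c" for a b s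
      using C_isolated[OF that(1) _ that(3)] w that c by auto
    then have "(\<exists>a b. w = a @ b \<and> b \<noteq> [] \<and> (\<exists>s\<in>C. word_coeff g \<nu> b s \<noteq> 0 \<and> word_map g b s = c)) \<longleftrightarrow>
        (\<exists>a b. w = a @ b \<and> b \<noteq> [] \<and> word_map g b c = c \<and> word_coeff g \<nu> b c \<noteq> 0)"
      using c by metis
    moreover have "c \<in> M" using c C_subset by blast
    ultimately show ?thesis
      unfolding fresh_def mem_Collect_eq by simp
  qed
  then show ?thesis
    unfolding words_no_final_cycle_def mem_Collect_eq final_cycle_iff[OF w] using w by (simp only: simp_thms)
qed

definition fresh_mass :: "nat \<Rightarrow> 'k \<Rightarrow> 't \<Rightarrow> real"
  where "fresh_mass n v d = (\<Sum>w\<in>words_of_length N n. if d \<in> fresh w then mass (word_map W w v) d else 0)"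

text \<open>Each piece of mass is counted once, at its first visit to \<open>C\<close>, time
  \<open>0\<close> included. These will be the partial frame sums over words of length at most
  \<open>n\<close>.\<close>

definition visit_mass :: "nat \<Rightarrow> 'k \<Rightarrow> real"
  where "visit_mass n v = (\<Sum>k\<le>n. \<Sum>c\<in>C. fresh_mass k v c)"

definition residual_mass :: "nat \<Rightarrow> 'k \<Rightarrow> real"
  where "residual_mass n v = (\<Sum>d\<in>M - C. fresh_mass n v d)"

lemma fresh_mass_nonneg: "0 \<le> fresh_mass n v d"
  unfolding fresh_mass_def by (intro sum_nonneg) simp

lemma finite_C: "finite C"
  using C_subset finite_M finite_subset by blast

lemma sum_fresh_mass:
  assumes "A \<subseteq> M"
  shows "(\<Sum>d\<in>A. fresh_mass n v d)
    = (\<Sum>w\<in>words_of_length N n. \<Sum>d\<in>A \<inter> fresh w. mass (word_map W w v) d)"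
proof -
  have "finite A" using assms finite_M finite_subset by blast
  then show ?thesis
    unfolding fresh_mass_def by (subst sum.swap) (simp add: sum.inter_restrict)
qed

text \<open>Unmarked fresh mass is carried over without loss, and mass on new points is always
  fresh; the latter is exactly the growth of \<open>level_mass\<close>.\<close>

lemma fresh_mass_step:
  "(\<Sum>d\<in>M. fresh_mass (Suc n) v d) = residual_mass n v + (level_mass (Suc n) v - level_mass n v)"
proof -
  have "(\<Sum>d\<in>M. fresh_mass (Suc n) v d)
      = (\<Sum>w\<in>words_of_length N (Suc n). \<Sum>d\<in>fresh w. mass (word_map W w v) d)"
    by (simp add: sum_fresh_mass Int_absorb1 fresh_subset)
  also have "\<dots> = (\<Sum>w\<in>words_of_length N n. \<Sum>i<N. \<Sum>d\<in>fresh (w @ [i]). mass (W i (word_map W w v)) d)"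
    by (simp add: sum_words_snoc)
  also have "\<dots> = (\<Sum>w\<in>words_of_length N n. (\<Sum>s\<in>fresh w - C. mass (word_map W w v) s) + new_mass (word_map W w v))"
  proof (intro sum.cong refl)
    fix w assume "w \<in> words_of_length N n"
    then have w: "w \<in> words N" by (simp add: words_of_length_def)
    have "fresh w - C \<subseteq> M" using fresh_subset by blast
    then show "(\<Sum>i<N. \<Sum>d\<in>fresh (w @ [i]). mass (W i (word_map W w v)) d)
      = (\<Sum>s\<in>fresh w - C. mass (word_map W w v) s) + new_mass (word_map W w v)"
      by (subst mass_step[symmetric]) (auto simp: fresh_snoc[OF w] intro!: sum.cong)
  qed
  also have "\<dots> = residual_mass n v + (level_mass (Suc n) v - level_mass n v)"
  proof -
    have "(M - C) \<inter> fresh w = fresh w - C" for w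
      using fresh_subset by blast
    then show ?thesis
      by (simp add: residual_mass_def sum_fresh_mass sum.distrib level_mass_step)
  qed
  finally show ?thesis .
qed

text \<open>At length \<open>0\<close> all of \<open>M\<close> is fresh; afterwards each step adds
  the new mass to the residual and moves what has reached \<open>C\<close> into the visits.\<close>

lemma level_mass_eq: "level_mass n v = visit_mass n v + residual_mass n v"
proof -
  have split: "(\<Sum>d\<in>M. fresh_mass k v d) = (\<Sum>c\<in>C. fresh_mass k v c) + residual_mass k v" for k
    unfolding residual_mass_def using sum.subset_diff[OF C_subset finite_M] by (metis add.commute)
  show ?thesis
  proof (induction n)
    case 0
    have "level_mass 0 v = (\<Sum>d\<in>M. fresh_mass 0 v d)"
      by (simp add: level_mass_def fresh_mass_def)
    then show ?case by (simp add: split visit_mass_def)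
  next
    case (Suc n)
    then show ?case
      using fresh_mass_step[of n v] split[of "Suc n"] by (simp add: visit_mass_def)
  qed
qed

lemma visit_mass_le: "visit_mass n v \<le> (norm v)\<^sup>2"
proof -
  have "0 \<le> residual_mass n v" unfolding residual_mass_def by (intro sum_nonneg fresh_mass_nonneg)
  then show ?thesis using level_mass_eq[of n v] level_mass_le[of n v] by argo
qed

text \<open>A fresh point outside \<open>C\<close> hands a fixed share of its mass to its child,
  which is still fresh. Words ending in other letters may also bring mass to \<open>g i d\<close>,
  hence only an inequality.\<close>

lemma fresh_mass_child:
  assumes d: "d \<in> M - C" and i: "i < N" and nz: "\<nu> i d \<noteq> 0"
  shows "(cmod (\<nu> i d))\<^sup>2 * fresh_mass n v d \<le> fresh_mass (Suc n) v (g i d)"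
proof -
  have gd: "g i d \<in> M" using inv_M d i nz by (auto simp: invariant_set_def)
  have "(cmod (\<nu> i d))\<^sup>2 * fresh_mass n v d
      = (\<Sum>w\<in>words_of_length N n. if d \<in> fresh w then mass (W i (word_map W w v)) (g i d) else 0)"
    unfolding fresh_mass_def sum_distrib_left using d
    by (intro sum.cong refl) (simp add: mass_W[OF i _ nz])
  also have "\<dots> \<le> (\<Sum>w\<in>words_of_length N n. \<Sum>j<N.
      if g i d \<in> fresh (w @ [j]) then mass (W j (word_map W w v)) (g i d) else 0)"
  proof (rule sum_mono)
    fix w assume "w \<in> words_of_length N n"
    then have w: "w \<in> words N" by (simp add: words_of_length_def)
    let ?f = "\<lambda>j. if g i d \<in> fresh (w @ [j]) then mass (W j (word_map W w v)) (g i d) else 0"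
    have "g i d \<in> fresh (w @ [i])" if "d \<in> fresh w"
      using gd that d inj_g[OF i] by (auto simp: fresh_snoc[OF w i] dest: injD)
    then have "(if d \<in> fresh w then mass (W i (word_map W w v)) (g i d) else 0) \<le> ?f i"
      by simp
    also have "\<dots> \<le> (\<Sum>j<N. ?f j)"
      using i by (intro member_le_sum) auto
    finally show "(if d \<in> fresh w then mass (W i (word_map W w v)) (g i d) else 0) \<le> (\<Sum>j<N. ?f j)" .
  qed
  also have "\<dots> = fresh_mass (Suc n) v (g i d)"
    by (simp add: fresh_mass_def sum_words_snoc cong: if_cong)
  finally show ?thesis .
qed

text \<open>First visits form a series whose partial sums \<open>visit_mass\<close> are bounded, so
  its terms tend to \<open>0\<close>.\<close>

lemma fresh_mass_C_tendsto:
  assumes "c \<in> C"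
  shows "(\<lambda>n. fresh_mass n v c) \<longlonglongrightarrow> 0"
proof -
  have "summable (\<lambda>k. \<Sum>c\<in>C. fresh_mass k v c)"
    using visit_mass_le by (intro bounded_imp_summable[of _ "(norm v)\<^sup>2"] sum_nonneg fresh_mass_nonneg)
      (simp add: visit_mass_def)
  then have "(\<lambda>k. \<Sum>c\<in>C. fresh_mass k v c) \<longlonglongrightarrow> 0"
    by (rule summable_LIMSEQ_zero)
  then show ?thesis
  proof (rule tendsto_sandwich[OF _ _ tendsto_const, rotated 2])
    show "\<forall>\<^sub>F n in sequentially. fresh_mass n v c \<le> (\<Sum>c\<in>C. fresh_mass n v c)"
      using assms finite_C by (intro always_eventually allI member_le_sum fresh_mass_nonneg)
  qed (simp add: fresh_mass_nonneg)
qed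

text \<open>Induction on a possible word from \<open>d\<close> to \<open>C\<close>: by
  \<open>fresh_mass_child\<close> the mass at \<open>d\<close> is at most a constant times the mass
  at the next point one step later.\<close>

lemma fresh_mass_tendsto:
  assumes "d \<in> M"
  shows "(\<lambda>n. fresh_mass n v d) \<longlonglongrightarrow> 0"
proof -
  obtain w where "w \<in> words N" "word_map g w d \<in> C" "word_coeff g \<nu> w d \<noteq> 0"
    using C_reached assms by blast
  then show ?thesis
    using assms
  proof (induction w arbitrary: d)
    case Nil
    then show ?case by (simp add: fresh_mass_C_tendsto)
  next
    case (Cons i w)
    show ?case
    proof (cases "d \<in> C")
      case True
      then show ?thesis by (rule fresh_mass_C_tendsto)
    next
      case False
      have i: "i < N" "\<nu> i d \<noteq> 0" and d: "d \<in> M - C"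
        using Cons.prems False by auto
      have "g i d \<in> M"
        using inv_M d i by (auto simp: invariant_set_def)
      then have "(\<lambda>n. fresh_mass n v (g i d)) \<longlonglongrightarrow> 0"
        using Cons by auto
      then have lim: "(\<lambda>n. fresh_mass (Suc n) v (g i d) / (cmod (\<nu> i d))\<^sup>2) \<longlonglongrightarrow> 0 / (cmod (\<nu> i d))\<^sup>2"
        using i by (intro tendsto_intros LIMSEQ_Suc) auto
      show ?thesis
      proof (rule tendsto_sandwich[OF _ _ tendsto_const])
        show "\<forall>\<^sub>F n in sequentially. fresh_mass n v d \<le> fresh_mass (Suc n) v (g i d) / (cmod (\<nu> i d))\<^sup>2"
          using fresh_mass_child[OF d i(1) i(2)] i by (intro always_eventually allI) (simp add: field_simps)
      qed (use lim in \<open>simp_all add: fresh_mass_nonneg\<close>)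
    qed
  qed
qed

lemma visit_mass_tendsto: "(\<lambda>n. visit_mass n v) \<longlonglongrightarrow> limit_mass v"
proof -
  have "(\<lambda>n. residual_mass n v) \<longlonglongrightarrow> (\<Sum>d\<in>M - C. 0)"
    unfolding residual_mass_def by (intro tendsto_sum fresh_mass_tendsto) auto
  then have "(\<lambda>n. level_mass n v - residual_mass n v) \<longlonglongrightarrow> limit_mass v - 0"
    by (intro tendsto_diff level_mass_tendsto) simp
  then show ?thesis by (simp add: level_mass_eq)
qed

text \<open>The sets \<open>I n\<close>, with words of length at most \<open>n\<close>, exhaust the
  index set, and \<open>C_fresh_iff\<close> identifies the sum over \<open>I n\<close> with
  \<open>visit_mass n v\<close>. As the terms are nonnegative, this one exhaustion determines the
  unordered sum.\<close>

lemma frame_has_sum: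
  "((\<lambda>(c, w). (cmod (cinner v (word_op V w (e c))))\<^sup>2) has_sum limit_mass v)
    (SIGMA c:C. words_no_final_cycle N g \<nu> c)"
proof -
  let ?I = "SIGMA c:C. words_no_final_cycle N g \<nu> c"
  let ?f = "\<lambda>(c, w). (cmod (cinner v (word_op V w (e c))))\<^sup>2"
  define I where "I n = {(c, w). c \<in> C \<and> w \<in> words_no_final_cycle N g \<nu> c \<and> length w \<le> n}" for n
  have I_eq: "I n = (SIGMA c:C. \<Union>k\<le>n. {w \<in> words_of_length N k. c \<in> fresh w})" for n
    using C_fresh_iff by (auto simp: I_def words_of_length_def words_no_final_cycle_def)
  have fin: "finite (I n)" for n
    unfolding I_eq using finite_C by auto
  have "sum ?f (I n) = visit_mass n v" for n
  proof -
    have "sum ?f (I n) = (\<Sum>c\<in>C. \<Sum>w\<in>(\<Union>k\<le>n. {w \<in> words_of_length N k. c \<in> fresh w}).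
        (cmod (cinner v (word_op V w (e c))))\<^sup>2)"
      unfolding I_eq using finite_C by (subst sum.Sigma) auto
    also have "\<dots> = (\<Sum>c\<in>C. \<Sum>k\<le>n. \<Sum>w\<in>{w \<in> words_of_length N k. c \<in> fresh w}.
        (cmod (cinner v (word_op V w (e c))))\<^sup>2)"
      by (intro sum.cong refl sum.UNION_disjoint) (simp_all, auto simp: words_of_length_def)
    also have "\<dots> = (\<Sum>c\<in>C. \<Sum>k\<le>n. fresh_mass k v c)"
      unfolding fresh_mass_def
      by (subst sum.inter_filter[OF finite_words_of_length], intro sum.cong refl)
        (simp add: words_of_length_def word_op_adjoint)
    also have "\<dots> = visit_mass n v"
      unfolding visit_mass_def by (rule sum.swap)
    finally show ?thesis .
  qed
  then have lim: "(\<lambda>n. sum ?f (I n)) \<longlonglongrightarrow> limit_mass v"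
    using visit_mass_tendsto by simp
  have sub: "\<exists>n. F \<subseteq> I n" if "finite F" "F \<subseteq> ?I" for F
    using that
  proof (induction F rule: finite_induct)
    case (insert p F)
    then obtain n where "F \<subseteq> I n" by blast
    moreover have "p \<in> I (length (snd p))"
      using insert.prems by (auto simp: I_def)
    ultimately have "insert p F \<subseteq> I (max n (length (snd p)))"
      by (auto simp: I_def)
    then show ?case by blast
  qed simp
  have I_sub: "I n \<subseteq> ?I" for n by (auto simp: I_def)
  have "incseq (\<lambda>n. sum ?f (I n))"
    by (intro monoI sum_mono2 fin) (auto simp: I_def)
  then have upper: "sum ?f (I n) \<le> limit_mass v" for n
    using lim by (rule incseq_le)
  show ?thesis
    unfolding has_sum_def
  proof (rule order_tendstoI)
    fix a assume "a < limit_mass v"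
    then obtain n where n: "a < sum ?f (I n)"
      using order_tendstoD(1)[OF lim] eventually_sequentially by (metis (lifting) order_refl)
    show "\<forall>\<^sub>F F in finite_subsets_at_top ?I. a < sum ?f F"
      unfolding eventually_finite_subsets_at_top
    proof (intro exI[of _ "I n"] conjI allI impI fin I_sub)
      fix F assume "finite F \<and> I n \<subseteq> F \<and> F \<subseteq> ?I"
      then have "sum ?f (I n) \<le> sum ?f F"
        by (intro sum_mono2) auto
      then show "a < sum ?f F" using n by linarith
    qed
  next
    fix a assume "limit_mass v < a"
    have "sum ?f F < a" if F: "finite F" "F \<subseteq> ?I" for F
    proof -
      obtain n where "F \<subseteq> I n" using sub F by blast
      then have "sum ?f F \<le> sum ?f (I n)"
        by (intro sum_mono2 fin) auto
      then show ?thesis using upper[of n] \<open>limit_mass v < a\<close> by linarith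
    qed
    then show "\<forall>\<^sub>F F in finite_subsets_at_top ?I. sum ?f F < a"
      unfolding eventually_finite_subsets_at_top by blast
  qed
qed

end

section \<open>Minimal compact invariant sets\<close>

text \<open>Zorn's lemma for reverse inclusion; compactness of \<open>Y\<close> keeps the
  intersection of a chain nonempty.\<close>

lemma minimal_compact_invariant_subset:
  fixes Y :: "'t::metric_space set"
  assumes Y: "compact Y" "Y \<noteq> {}" "invariant_set N g \<nu> Y"
  obtains Z where "minimal_compact_invariant_set N g \<nu> Z" "Z \<subseteq> Y"
proof -
  define A where "A = {Z. Z \<subseteq> Y \<and> Z \<noteq> {} \<and> closed Z \<and> invariant_set N g \<nu> Z}"
  have "\<exists>m\<in>A. \<forall>a\<in>A. a \<subseteq> m \<longrightarrow> a = m"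
  proof (rule predicate_Zorn)
    show "partial_order_on A (relation_of (\<lambda>x y. y \<subseteq> x) A)"
      by (auto simp: partial_order_on_def preorder_on_def relation_of_def
          refl_on_def trans_def antisym_def)
    fix F assume "F \<in> Chains (relation_of (\<lambda>x y. y \<subseteq> x) A)"
    then have F: "F \<subseteq> A" and chain: "\<And>S T. S \<in> F \<Longrightarrow> T \<in> F \<Longrightarrow> S \<subseteq> T \<or> T \<subseteq> S"
      unfolding Chains_def relation_of_def by fast+
    \<comment> \<open>A finite chain has a least member; adding \<open>Y\<close> covers the empty
      chain.\<close>
    have "\<exists>m\<in>insert Y G. \<forall>a\<in>insert Y G. m \<subseteq> a" if "finite G" "G \<subseteq> F" for G
      using that
    proof (induction G rule: finite_induct)
      case (insert x G)
      then obtain m where m: "m \<in> insert Y G" "\<forall>a\<in>insert Y G. m \<subseteq> a" by auto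
      have "m \<subseteq> x \<or> x \<subseteq> m"
        using chain insert.prems m(1) F by (auto simp: A_def)
      then show ?case
      proof
        assume "m \<subseteq> x"
        then show ?thesis using m by (intro bexI[of _ m]) auto
      next
        assume "x \<subseteq> m"
        then show ?thesis using m by (intro bexI[of _ x]) auto
      qed
    qed simp
    moreover have "m \<noteq> {}" if "m \<in> insert Y G" "G \<subseteq> F" for m G
      using that F Y(2) by (auto simp: A_def)
    ultimately have fip: "Y \<inter> \<Inter>G \<noteq> {}" if "finite G" "G \<subseteq> F" for G
      using that by (metis Inter_insert Inter_greatest subset_empty)
    have "Y \<inter> \<Inter>F \<noteq> {}"
      by (rule compact_imp_fip[OF Y(1) _ fip]) (use F in \<open>auto simp: A_def\<close>)
    moreover have "closed (Y \<inter> \<Inter>F)"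
      using F Y(1) by (intro closed_Int closed_Inter compact_imp_closed) (auto simp: A_def)
    moreover have "invariant_set N g \<nu> (Y \<inter> \<Inter>F)"
      using F Y(3) unfolding A_def invariant_set_def by blast
    ultimately have "Y \<inter> \<Inter>F \<in> A" by (auto simp: A_def)
    then show "\<exists>u\<in>A. \<forall>a\<in>F. u \<subseteq> a" by (rule bexI[rotated]) auto
  qed
  then obtain Z where Z: "Z \<in> A" "\<And>a. a \<in> A \<Longrightarrow> a \<subseteq> Z \<Longrightarrow> a = Z" by blast
  have "compact Z"
    using Z(1) Y(1) closed_Int_compact[of Z Y] by (auto simp: A_def Int_absorb2)
  moreover have "\<not> (\<exists>M'. M' \<noteq> {} \<and> M' \<subset> Z \<and> closed M' \<and> invariant_set N g \<nu> M')"
  proof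
    assume "\<exists>M'. M' \<noteq> {} \<and> M' \<subset> Z \<and> closed M' \<and> invariant_set N g \<nu> M'"
    then obtain M' where M': "M' \<noteq> {}" "M' \<subset> Z" "closed M'" "invariant_set N g \<nu> M'" by blast
    then have "M' \<in> A" using Z(1) by (auto simp: A_def)
    then show False using Z(2) M'(2) by blast
  qed
  ultimately have "minimal_compact_invariant_set N g \<nu> Z"
    using Z(1) by (simp add: minimal_compact_invariant_set_def minimal_invariant_set_def A_def)
  then show thesis using that Z(1) by (auto simp: A_def)
qed

lemma minimal_compact_invariant_subset_eq:
  assumes "minimal_compact_invariant_set N g \<nu> Z" "M' \<subseteq> Z" "M' \<noteq> {}" "closed M'" "invariant_set N g \<nu> M'"
  shows "M' = Z"
proof (rule ccontr)
  assume "M' \<noteq> Z"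
  then have "\<exists>M'. M' \<noteq> {} \<and> M' \<subset> Z \<and> closed M' \<and> invariant_set N g \<nu> M'"
    using assms(2-) by (intro exI[of _ M']) (simp add: psubset_eq)
  moreover have "\<not> (\<exists>M'. M' \<noteq> {} \<and> M' \<subset> Z \<and> closed M' \<and> invariant_set N g \<nu> M')"
    using assms(1) by (simp only: minimal_compact_invariant_set_def minimal_invariant_set_def simp_thms)
  ultimately show False by (rule notE[rotated])
qed

lemma minimal_compact_invariant_disjoint:
  assumes "minimal_compact_invariant_set N g \<nu> Z" "minimal_compact_invariant_set N g \<nu> Z'" "Z \<inter> Z' \<noteq> {}"
  shows "Z = Z'"
proof -
  have "closed (Z \<inter> Z')" "invariant_set N g \<nu> (Z \<inter> Z')"
    using assms(1,2)
    by (auto simp: minimal_compact_invariant_set_def minimal_invariant_set_def invariant_set_def)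
  then show ?thesis
    using minimal_compact_invariant_subset_eq[OF assms(1)] minimal_compact_invariant_subset_eq[OF assms(2)] assms(3)
    by (metis inf_le1 inf_le2)
qed

text \<open>The points reachable from \<open>s\<close> form a nonempty invariant subset of
  \<open>Z\<close>. Being finite it is closed, so minimality makes it all of
  \<open>Z\<close>.\<close>

lemma minimal_invariant_reaches:
  fixes Z :: "'t::metric_space set"
  assumes min: "minimal_compact_invariant_set N g \<nu> Z" and fin: "finite Z" and s: "s \<in> Z" and t: "t \<in> Z"
  shows "\<exists>w\<in>words N. word_map g w s = t \<and> word_coeff g \<nu> w s \<noteq> 0"
proof -
  let ?O = "{word_map g w s | w. w \<in> words N \<and> word_coeff g \<nu> w s \<noteq> 0}"
  have inv: "invariant_set N g \<nu> Z"
    using min by (simp add: minimal_compact_invariant_set_def minimal_invariant_set_def)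
  have sub: "?O \<subseteq> Z"
    using invariant_set_word_map[OF inv] s by blast
  have "invariant_set N g \<nu> ?O"
    unfolding invariant_set_def
  proof (intro ballI allI impI)
    fix u i assume "u \<in> ?O" "i < N" "\<nu> i u \<noteq> 0"
    then obtain w where "w \<in> words N" "word_coeff g \<nu> w s \<noteq> 0" "u = word_map g w s" by blast
    then have "w @ [i] \<in> words N \<and> word_coeff g \<nu> (w @ [i]) s \<noteq> 0 \<and> g i u = word_map g (w @ [i]) s"
      using \<open>i < N\<close> \<open>\<nu> i u \<noteq> 0\<close> by simp
    then show "g i u \<in> ?O" by blast
  qed
  moreover have "word_map g [] s \<in> ?O"
    by (rule CollectI) (intro exI[of _ "[]"], simp)
  then have "?O \<noteq> {}" by blast
  moreover have "closed ?O"
    using sub fin finite_subset finite_imp_closed by blast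
  ultimately have "?O = Z"
    using minimal_compact_invariant_subset_eq[OF min sub] by blast
  then show ?thesis using t by blast
qed

section \<open>Contractive systems: compact orbit closures, separation and orthonormality\<close>

locale contractive_walk = row_walk N V e g \<nu>
  for N and V :: "nat \<Rightarrow> 'k::complex_hilbert \<Rightarrow> 'k" and e :: "'t::complete_space \<Rightarrow> 'k" and g \<nu> +
  assumes cont_e: "continuous_on UNIV e"
    and dense_e: "closed_cspan (range e) = UNIV"
    and contraction_g: "i < N \<Longrightarrow> is_contraction (g i)"
    and injective_g: "i < N \<Longrightarrow> inj (g i)"
    and finite_min: "minimal_compact_invariant_set N g \<nu> Z \<Longrightarrow> finite Z"
begin

text \<open>Among finitely many letters the largest contraction ratio serves for all.\<close>

lemma word_contraction:
  obtains c where "0 < c" "c < 1"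
    "\<And>w x y. w \<in> words N \<Longrightarrow> dist (word_map g w x) (word_map g w y) \<le> c ^ length w * dist x y"
proof -
  have "\<forall>i<N. \<exists>c. 0 < c \<and> c < 1 \<and> (\<forall>x y. dist (g i x) (g i y) \<le> c * dist x y)"
    using contraction_g by (simp add: is_contraction_def)
  then obtain c where c: "\<And>i. i < N \<Longrightarrow> 0 < c i \<and> c i < 1 \<and> (\<forall>x y. dist (g i x) (g i y) \<le> c i * dist x y)"
    by metis
  have "0 < N" using row by (simp add: row_coisometry_def)
  define m where "m = Max (c ` {..<N})"
  have le: "c i \<le> m" if "i < N" for i
    unfolding m_def using that by (intro Max_ge) auto
  have "m \<in> c ` {..<N}"
    unfolding m_def using \<open>0 < N\<close> by (intro Max_in) auto
  then have m: "0 < m" "m < 1" using c by auto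
  have "dist (g i x) (g i y) \<le> m * dist x y" if "i < N" for i x y
    using c[OF that] le[OF that] by (meson mult_right_mono order_trans zero_le_dist)
  then have "dist (word_map g w x) (word_map g w y) \<le> m ^ length w * dist x y" if "w \<in> words N" for w x y
    using that
  proof (induction w arbitrary: x y)
    case (Cons i w)
    then have "dist (word_map g w (g i x)) (word_map g w (g i y)) \<le> m ^ length w * dist (g i x) (g i y)"
      by simp
    also have "\<dots> \<le> m ^ length w * (m * dist x y)"
      using Cons m by (intro mult_left_mono) auto
    finally show ?case by (simp add: mult_ac)
  qed simp
  then show thesis using that m by blast
qed

lemma words_of_length_contract:
  assumes "\<epsilon> > 0"
  obtains n where "\<And>w x y. \<lbrakk>w \<in> words N; n \<le> length w; dist x y \<le> B\<rbrakk>
    \<Longrightarrow> dist (word_map g w x) (word_map g w y) < \<epsilon>"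
proof -
  obtain c where c: "0 < c" "c < 1"
    "\<And>w x y. w \<in> words N \<Longrightarrow> dist (word_map g w x) (word_map g w y) \<le> c ^ length w * dist x y"
    using word_contraction by blast
  \<comment> \<open>\<open>B\<close> carries no sign, hence the absolute value.\<close>
  have "(\<lambda>n. c ^ n * \<bar>B\<bar>) \<longlonglongrightarrow> 0 * \<bar>B\<bar>"
    using c by (intro tendsto_intros LIMSEQ_power_zero) auto
  then have "\<forall>\<^sub>F n in sequentially. c ^ n * \<bar>B\<bar> < \<epsilon>"
    using assms by (intro order_tendstoD(2)) auto
  then obtain n where n: "c ^ n * \<bar>B\<bar> < \<epsilon>"
    by (auto simp: eventually_sequentially)
  have "dist (word_map g w x) (word_map g w y) < \<epsilon>"
    if w: "w \<in> words N" "n \<le> length w" "dist x y \<le> B" for w x y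
  proof -
    have "c ^ length w * dist x y \<le> c ^ n * \<bar>B\<bar>"
      using c w by (intro mult_mono power_decreasing) auto
    then show ?thesis using c(3)[OF w(1), of x y] n by linarith
  qed
  then show thesis using that by blast
qed

text \<open>All words count, whatever their coefficients. The set is therefore stable under every
  \<open>g i\<close>, not only along possible transitions.\<close>

definition orbit_closure :: "'t \<Rightarrow> 't set"
  where "orbit_closure t = closure ((\<lambda>w. word_map g w t) ` words N)"

lemma orbit_closure_word: "w \<in> words N \<Longrightarrow> word_map g w t \<in> orbit_closure t"
  unfolding orbit_closure_def by (intro subsetD[OF closure_subset] imageI)

lemma orbit_closure_self: "t \<in> orbit_closure t"
  using orbit_closure_word[of "[]"] by simp

lemma orbit_closure_bounded:
  obtains B where "\<And>w. w \<in> words N \<Longrightarrow> dist (word_map g w t) t \<le> B"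
proof -
  obtain c where c: "0 < c" "c < 1"
    "\<And>w x y. w \<in> words N \<Longrightarrow> dist (word_map g w x) (word_map g w y) \<le> c ^ length w * dist x y"
    using word_contraction by blast
  define b where "b = Max ((\<lambda>i. dist (g i t) t) ` {..<N})"
  have b: "dist (g i t) t \<le> b" if "i < N" for i
    unfolding b_def using that by (intro Max_ge) auto
  \<comment> \<open>\<open>b / (1 - c)\<close> is the fixed point of
    \<open>r \<mapsto> c * r + b\<close>, the recursion for the bound when a letter is
    appended.\<close>
  have "dist (word_map g w t) t \<le> b / (1 - c)" if "w \<in> words N" for w
    using that
  proof (induction w rule: rev_induct)
    case Nil
    have "0 < N" using row by (simp add: row_coisometry_def)
    then have "0 \<le> b" using b zero_le_dist order_trans by blast
    then show ?case using c by simp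
  next
    case (snoc i w)
    then have i: "i < N" by simp
    have "dist (g i (word_map g w t)) (g i t) \<le> c * dist (word_map g w t) t"
      using c(3)[of "[i]"] i by simp
    also have "\<dots> \<le> c * (b / (1 - c))"
      using snoc c by (intro mult_left_mono) auto
    finally have "dist (g i (word_map g w t)) t \<le> c * (b / (1 - c)) + b"
      using dist_triangle[of "g i (word_map g w t)" t "g i t"] b[OF i] by linarith
    also have "\<dots> = b / (1 - c)"
      using c by (simp add: field_simps)
    finally show ?case by simp
  qed
  then show thesis using that by blast
qed

text \<open>The last \<open>n\<close> letters of a long word contract the bounded orbit so strongly
  that the endpoint is close to the one given by those letters alone. Words of length at most
  \<open>n\<close> thus yield a finite net.\<close>

lemma compact_orbit_closure: "compact (orbit_closure t)"
  unfolding compact_eq_totally_bounded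
proof (intro conjI allI impI)
  show "complete (orbit_closure t)"
    unfolding orbit_closure_def by (simp add: complete_eq_closed)
  fix \<epsilon> :: real assume "\<epsilon> > 0"
  obtain B where B: "\<And>w. w \<in> words N \<Longrightarrow> dist (word_map g w t) t \<le> B"
    using orbit_closure_bounded by blast
  obtain n where n: "\<And>w x y. \<lbrakk>w \<in> words N; n \<le> length w; dist x y \<le> B\<rbrakk>
    \<Longrightarrow> dist (word_map g w x) (word_map g w y) < \<epsilon> / 2"
    using words_of_length_contract[of "\<epsilon> / 2" B] \<open>\<epsilon> > 0\<close> by auto
  define k where "k = (\<lambda>w. word_map g w t) ` (\<Union>m\<le>n. words_of_length N m)"
  have "(\<lambda>w. word_map g w t) ` words N \<subseteq> (\<Union>x\<in>k. cball x (\<epsilon> / 2))"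
  proof (intro image_subsetI)
    fix w assume w: "w \<in> words N"
    show "word_map g w t \<in> (\<Union>x\<in>k. cball x (\<epsilon> / 2))"
    proof (cases "length w \<le> n")
      case True
      then have "word_map g w t \<in> k" using w by (auto simp: k_def words_of_length_def)
      then show ?thesis using \<open>\<epsilon> > 0\<close> by force
    next
      case False
      define v where "v = take (length w - n) w"
      define u where "u = drop (length w - n) w"
      have wvu: "w = v @ u" "length u = n" using False by (auto simp: v_def u_def)
      then have uv: "u \<in> words N" "v \<in> words N" using w by auto
      have "dist (word_map g u (word_map g v t)) (word_map g u t) < \<epsilon> / 2"
        using n[OF uv(1)] B[OF uv(2)] wvu by simp
      moreover have "word_map g u t \<in> k" using uv wvu by (auto simp: k_def words_of_length_def)
      ultimately show ?thesis
        unfolding wvu(1) word_map_append by (force simp: dist_commute)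
    qed
  qed
  moreover have "finite k" by (simp add: k_def)
  \<comment> \<open>Closed balls of half the radius allow passing to the closure before returning to
    open balls of radius \<open>\<epsilon>\<close>.\<close>
  then have "closed (\<Union>x\<in>k. cball x (\<epsilon> / 2))" by (intro closed_UN) auto
  ultimately have "orbit_closure t \<subseteq> (\<Union>x\<in>k. cball x (\<epsilon> / 2))"
    unfolding orbit_closure_def by (rule closure_minimal)
  also have "\<dots> \<subseteq> (\<Union>x\<in>k. ball x \<epsilon>)"
    using \<open>\<epsilon> > 0\<close> by (intro UN_mono) auto
  finally show "\<exists>k. finite k \<and> orbit_closure t \<subseteq> (\<Union>x\<in>k. ball x \<epsilon>)"
    using \<open>finite k\<close> by blast
qed

lemma orbit_closure_g: "i < N \<Longrightarrow> s \<in> orbit_closure t \<Longrightarrow> g i s \<in> orbit_closure t"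
proof -
  assume i: "i < N" and s: "s \<in> orbit_closure t"
  obtain c where c: "0 < c" "\<And>x y. dist (g i x) (g i y) \<le> c * dist x y"
    using contraction_g[OF i] by (auto simp: is_contraction_def)
  have "continuous_on UNIV (g i)"
    by (rule lipschitz_on_continuous_on[of c]) (use c in \<open>auto intro: lipschitz_onI\<close>)
  moreover have "g i ` (\<lambda>w. word_map g w t) ` words N \<subseteq> orbit_closure t"
  proof (intro image_subsetI)
    fix x assume "x \<in> (\<lambda>w. word_map g w t) ` words N"
    then obtain w where "w \<in> words N" "x = word_map g w t" by blast
    then show "g i x \<in> orbit_closure t"
      using orbit_closure_word[of "w @ [i]" t] i by simp
  qed
  ultimately have "g i ` closure ((\<lambda>w. word_map g w t) ` words N) \<subseteq> orbit_closure t"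
    by (intro image_closure_subset) (auto simp: orbit_closure_def intro: continuous_on_subset)
  then show ?thesis using s by (auto simp: orbit_closure_def)
qed

text \<open>If both coefficients survive a long word, both endpoints lie in the finite set
  \<open>M\<close> and are closer than any two distinct points of it, hence coincide; injectivity
  then forces \<open>s = t\<close>.\<close>

lemma separation:
  assumes M: "finite M" "invariant_set N g \<nu> M" and st: "s \<in> M" "t \<in> M" "s \<noteq> t"
  obtains n where "\<And>w. \<lbrakk>w \<in> words N; n \<le> length w\<rbrakk> \<Longrightarrow> word_coeff g \<nu> w s = 0 \<or> word_coeff g \<nu> w t = 0"
proof -
  obtain \<delta> where \<delta>: "\<delta> > 0" "\<And>x y. \<lbrakk>x \<in> M; y \<in> M; dist x y < \<delta>\<rbrakk> \<Longrightarrow> x = y"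
  proof -
    let ?D = "insert 1 ((\<lambda>(x, y). dist x y) ` {(x, y) \<in> M \<times> M. x \<noteq> y})"
    have "finite {(x, y) \<in> M \<times> M. x \<noteq> y}"
      by (rule finite_subset[of _ "M \<times> M"]) (use M(1) in auto)
    then have fin: "finite ?D" by simp
    then have "Min ?D \<in> ?D" by (intro Min_in) auto
    then have "Min ?D > 0" by auto
    moreover have "x = y" if "x \<in> M" "y \<in> M" "dist x y < Min ?D" for x y
    proof (rule ccontr)
      assume "x \<noteq> y"
      then have "Min ?D \<le> dist x y" using fin that by (intro Min_le) auto
      then show False using that by simp
    qed
    ultimately show thesis using that by blast
  qed
  obtain n where n: "\<And>w x y. \<lbrakk>w \<in> words N; n \<le> length w; dist x y \<le> dist s t\<rbrakk>
    \<Longrightarrow> dist (word_map g w x) (word_map g w y) < \<delta>"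
    using words_of_length_contract[OF \<delta>(1), of "dist s t"] by blast
  have inj: "inj (word_map g w)" if "w \<in> words N" for w
    using that
  proof (induction w)
    case (Cons i w)
    then have "inj (word_map g w \<circ> g i)"
      using injective_g by (intro inj_compose) auto
    then show ?case by (simp add: inj_def)
  qed (simp add: inj_def)
  have "word_coeff g \<nu> w s = 0 \<or> word_coeff g \<nu> w t = 0" if w: "w \<in> words N" "n \<le> length w" for w
  proof (rule ccontr)
    assume "\<not> ?thesis"
    then have "word_map g w s \<in> M" "word_map g w t \<in> M"
      using invariant_set_word_map[OF M(2) w(1)] st by auto
    then have "word_map g w s = word_map g w t"
      using \<delta>(2) n[OF w] by blast
    then show False using inj[OF w(1)] st(3) by (auto dest: injD)
  qed
  then show thesis using that by blast
qed

text \<open>The inner product is a sum over the words of length \<open>n\<close>, and for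
  \<open>n\<close> from \<open>separation\<close> each term contains a vanishing
  coefficient.\<close>

lemma orthonormal:
  assumes M: "finite M" "invariant_set N g \<nu> M" and st: "s \<in> M" "t \<in> M"
  shows "cinner (e s) (e t) = (if s = t then 1 else 0)"
proof (cases "s = t")
  case False
  obtain n where n: "\<And>w. \<lbrakk>w \<in> words N; n \<le> length w\<rbrakk> \<Longrightarrow> word_coeff g \<nu> w s = 0 \<or> word_coeff g \<nu> w t = 0"
    using separation[OF M st False] by blast
  have "cinner (e s) (e t) = (\<Sum>w\<in>words_of_length N n. cinner (word_map W w (e s)) (word_map W w (e t)))"
    by (rule cinner_words_sum[symmetric])
  also have "\<dots> = 0"
  proof (intro sum.neutral ballI)
    fix w assume "w \<in> words_of_length N n"
    then have "w \<in> words N" "n \<le> length w" by (auto simp: words_of_length_def)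
    then show "cinner (word_map W w (e s)) (word_map W w (e t)) = 0"
      using n[of w] by (auto simp: word_W_e cinner_scaleC_left cinner_scaleC_right)
  qed
  finally show ?thesis using False by simp
qed simp

section \<open>Finitely many minimal sets, and the walk on each of them\<close>

abbreviation minimal_sets :: "'t set set"
  where "minimal_sets \<equiv> {Z. minimal_compact_invariant_set N g \<nu> Z}"

text \<open>Some word of length \<open>n\<close> has nonzero coefficient at
  \<open>s \<in> Z\<close>, as the squared norms over all such words add up to \<open>1\<close>. Its
  endpoint from \<open>s\<close> is in \<open>Z\<close>, that from \<open>t\<close> in the orbit
  closure; contraction brings the two together, against the positive gap
  \<open>\<delta>\<close>.\<close>

lemma minimal_meets_orbit_closure:
  assumes "Z \<in> minimal_sets"
  shows "Z \<inter> orbit_closure t \<noteq> {}"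
proof
  assume disj: "Z \<inter> orbit_closure t = {}"
  have Z: "compact Z" "Z \<noteq> {}" "invariant_set N g \<nu> Z"
    using assms by (auto simp: minimal_compact_invariant_set_def minimal_invariant_set_def)
  obtain s where s: "s \<in> Z" using Z by blast
  define \<delta> where "\<delta> = Min ((\<lambda>x. infdist x (orbit_closure t)) ` Z)"
  have fin: "finite Z" using assms finite_min by blast
  have "infdist x (orbit_closure t) > 0" if "x \<in> Z" for x
  proof -
    have "closed (orbit_closure t)" "orbit_closure t \<noteq> {}"
      using orbit_closure_self[of t] by (auto simp: orbit_closure_def)
    then show ?thesis
      using in_closed_iff_infdist_zero[of "orbit_closure t" x] infdist_nonneg[of x "orbit_closure t"] disj that
      by force
  qed
  then have \<delta>: "\<delta> > 0"
    unfolding \<delta>_def using fin Z(2) by (subst Min_gr_iff) auto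
  have le: "\<delta> \<le> dist x y" if "x \<in> Z" "y \<in> orbit_closure t" for x y
  proof -
    have "\<delta> \<le> infdist x (orbit_closure t)"
      unfolding \<delta>_def using fin that by (intro Min_le) auto
    then show ?thesis using infdist_le[OF that(2), of x] by linarith
  qed
  obtain n where n: "\<And>w x y. \<lbrakk>w \<in> words N; n \<le> length w; dist x y \<le> dist s t\<rbrakk>
    \<Longrightarrow> dist (word_map g w x) (word_map g w y) < \<delta>"
    using words_of_length_contract[OF \<delta>, of "dist s t"] by blast
  have "(\<Sum>w\<in>words_of_length N n. (norm (word_map W w (e s)))\<^sup>2) \<noteq> 0"
    unfolding norm_words_sum by simp
  then obtain w where w: "w \<in> words_of_length N n" "word_map W w (e s) \<noteq> 0"
    by (metis (mono_tags, lifting) norm_zero sum.neutral zero_power2)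
  then have "w \<in> words N" "length w = n" by (auto simp: words_of_length_def)
  then have "word_coeff g \<nu> w s \<noteq> 0"
    using w(2) by (auto simp: word_W_e)
  then have "word_map g w s \<in> Z"
    using invariant_set_word_map[OF Z(3)] \<open>w \<in> words N\<close> s by blast
  then have "\<delta> \<le> dist (word_map g w s) (word_map g w t)"
    using le orbit_closure_word \<open>w \<in> words N\<close> by blast
  then show False
    using n[of w s t] \<open>w \<in> words N\<close> \<open>length w = n\<close> by auto
qed

text \<open>A union of two minimal sets is again finite and invariant, so orthonormality also holds
  across different minimal sets.\<close>

lemma norm_e_diff:
  assumes "Z \<in> minimal_sets" "Z' \<in> minimal_sets" "s \<in> Z" "t \<in> Z'" "s \<noteq> t"
  shows "(norm (e s - e t))\<^sup>2 = 2"
proof -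
  have "finite (Z \<union> Z')" "invariant_set N g \<nu> (Z \<union> Z')"
    using assms finite_min
    by (auto simp: minimal_compact_invariant_set_def minimal_invariant_set_def invariant_set_def)
  then have "cinner (e s) (e t) = 0" "cinner (e t) (e s) = 0"
    using orthonormal[of "Z \<union> Z'"] assms by auto
  then have "complex_of_real ((norm (e s - e t))\<^sup>2) = complex_of_real 2"
    unfolding cinner_self[symmetric] by (simp add: cinner_diff_left cinner_diff_right)
  then show ?thesis by (simp only: of_real_eq_iff)
qed

text \<open>Disjointness makes the points picked from the minimal sets in one compact orbit closure
  distinct. Infinitely many would accumulate, and continuity of \<open>e\<close> would bring two of
  their vectors closer than \<open>1\<close>, against the squared distance \<open>2\<close>.\<close>

lemma finite_minimal_sets: "finite minimal_sets"
proof (rule ccontr)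
  assume inf: "infinite minimal_sets"
  \<comment> \<open>\<open>undefined\<close> is just an arbitrary base point.\<close>
  have "\<forall>Z\<in>minimal_sets. \<exists>s. s \<in> Z \<and> s \<in> orbit_closure undefined"
    using minimal_meets_orbit_closure by blast
  then obtain p where p: "\<And>Z. Z \<in> minimal_sets \<Longrightarrow> p Z \<in> Z \<and> p Z \<in> orbit_closure undefined"
    by metis
  have "inj_on p minimal_sets"
  proof (rule inj_onI)
    fix Z Z' assume Z: "Z \<in> minimal_sets" "Z' \<in> minimal_sets" "p Z = p Z'"
    then have "p Z \<in> Z \<inter> Z'" using p[of Z] p[of Z'] by simp
    then show "Z = Z'" using Z minimal_compact_invariant_disjoint[of N g \<nu> Z Z'] by blast
  qed
  then have "infinite (p ` minimal_sets)"
    using inf finite_imageD by blast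
  moreover have "p ` minimal_sets \<subseteq> orbit_closure undefined"
    using p by blast
  ultimately obtain x where x: "x islimpt (p ` minimal_sets)"
    using compact_orbit_closure[of undefined] unfolding compact_eq_Bolzano_Weierstrass by blast
  obtain \<delta> where \<delta>: "\<delta> > 0" "\<And>y. dist y x < \<delta> \<Longrightarrow> dist (e y) (e x) < 1/2"
    using cont_e unfolding continuous_on_iff by (metis UNIV_I zero_less_divide_1_iff zero_less_numeral)
  have "infinite (p ` minimal_sets \<inter> ball x \<delta>)"
    using x \<delta>(1) by (simp add: islimpt_eq_infinite_ball)
  then obtain y where y: "y \<in> p ` minimal_sets \<inter> ball x \<delta>"
    by (metis finite.emptyI equals0I)
  have "infinite (p ` minimal_sets \<inter> ball x \<delta> - {y})"
    using \<open>infinite (p ` minimal_sets \<inter> ball x \<delta>)\<close> by simp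
  then obtain z where z: "z \<in> p ` minimal_sets \<inter> ball x \<delta> - {y}"
    by (metis finite.emptyI equals0I)
  have "norm (e y - e z) < 1"
    using \<delta>(2)[of y] \<delta>(2)[of z] y z dist_triangle2[of "e y" "e z" "e x"]
    by (auto simp: dist_commute[of x] dist_norm[symmetric])
  moreover obtain Y Z where "Y \<in> minimal_sets" "y \<in> Y" "Z \<in> minimal_sets" "z \<in> Z"
    using y z p by blast
  then have "(norm (e y - e z))\<^sup>2 = 2"
    using norm_e_diff z by blast
  ultimately show False
    using power_le_one[of "norm (e y - e z)" 2] by simp
qed

text \<open>The choice in \<open>h\<close> matters only after an impossible transition, where the
  coefficient of the word is already \<open>0\<close>. Irreducibility and separation therefore carry
  over from \<open>g\<close> to \<open>h\<close>.\<close>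

lemma walk_on_minimal_set:
  assumes Z: "minimal_compact_invariant_set N g \<nu> Z" and h: "is_walk_restriction N g \<nu> Z h"
  shows "acts_as_random_walk N V (closed_cspan (e ` Z)) Z e h \<nu> \<and>
    irreducible_walk N Z h \<nu> \<and> separating_walk N Z h \<nu>"
proof -
  have inv: "invariant_set N g \<nu> Z"
    using Z by (simp add: minimal_compact_invariant_set_def minimal_invariant_set_def)
  have fin: "finite Z" using finite_min Z .
  have hZ: "h i t \<in> Z" "\<nu> i t \<noteq> 0 \<Longrightarrow> h i t = g i t" if "i < N" "t \<in> Z" for i t
    using h that by (auto simp: is_walk_restriction_def)
  have coeff: "word_coeff h \<nu> w t = word_coeff g \<nu> w t" if "w \<in> words N" "t \<in> Z" for w t
    using that
  proof (induction w arbitrary: t)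
    case (Cons i w)
    then show ?case using hZ[of i t] by (cases "\<nu> i t = 0") auto
  qed simp
  have map: "word_map h w t = word_map g w t" if "w \<in> words N" "t \<in> Z" "word_coeff g \<nu> w t \<noteq> 0" for w t
    using that
  proof (induction w arbitrary: t)
    case (Cons i w)
    then show ?case using hZ[of i t] by auto
  qed simp
  have adj: "W i (e t) = \<nu> i t *\<^sub>C e (h i t)" if "i < N" "t \<in> Z" for i t
    using adj_e hZ that by (cases "\<nu> i t = 0") auto
  let ?K = "closed_cspan (e ` Z)"
  have sub: "complex_vector.subspace ?K"
  proof (rule complex_vector.subspaceI)
    show "0 \<in> ?K"
      unfolding closed_cspan_def using closure_subset complex_vector.span_zero by blast
  next
    fix x y assume xy: "x \<in> ?K" "y \<in> ?K"
    then obtain X Y where X: "\<And>n. X n \<in> complex_vector.span (e ` Z)" "X \<longlonglongrightarrow> x"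
      and Y: "\<And>n. Y n \<in> complex_vector.span (e ` Z)" "Y \<longlonglongrightarrow> y"
      unfolding closed_cspan_def closure_sequential by blast
    have "(\<lambda>n. X n + Y n) \<longlonglongrightarrow> x + y" by (intro tendsto_intros X Y)
    then show "x + y \<in> ?K"
      unfolding closed_cspan_def closure_sequential
      using X(1) Y(1) by (intro exI[of _ "\<lambda>n. X n + Y n"]) (simp add: complex_vector.span_add)
  next
    fix a x assume "x \<in> ?K"
    then obtain X where X: "\<And>n. X n \<in> complex_vector.span (e ` Z)" "X \<longlonglongrightarrow> x"
      unfolding closed_cspan_def closure_sequential by blast
    have "norm (a *\<^sub>C X n - a *\<^sub>C x) = cmod a * norm (X n - x)" for n
      by (metis complex_vector.scale_right_diff_distrib norm_scaleC)
    moreover have "(\<lambda>n. cmod a * norm (X n - x)) \<longlonglongrightarrow> cmod a * norm (x - x)"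
      by (intro tendsto_intros X)
    ultimately have "(\<lambda>n. a *\<^sub>C X n) \<longlonglongrightarrow> a *\<^sub>C x"
      by (simp add: tendsto_dist_iff[of _ "a *\<^sub>C x"] dist_norm)
    then show "a *\<^sub>C x \<in> ?K"
      unfolding closed_cspan_def closure_sequential
      using X(1) by (intro exI[of _ "\<lambda>n. a *\<^sub>C X n"]) (simp add: complex_vector.span_scale)
  qed
  have W_K: "W i ` ?K \<subseteq> ?K" if i: "i < N" for i
  proof -
    have "W i x \<in> complex_vector.span (e ` Z)" if "x \<in> complex_vector.span (e ` Z)" for x
      using that
    proof (induction rule: complex_vector.span_induct_alt)
      case base
      have "W i 0 = 0" using cadjoint_add[OF V_bounded[OF i], of 0 0] by simp
      then show ?case by (simp add: complex_vector.span_zero)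
    next
      case (step c x y)
      then obtain t where t: "t \<in> Z" "x = e t" by blast
      then have "W i x \<in> complex_vector.span (e ` Z)"
        using adj[OF i] hZ(1)[OF i] by (simp add: complex_vector.span_scale complex_vector.span_base)
      then show ?case
        using step by (simp add: cadjoint_add cadjoint_scaleC V_bounded i complex_vector.span_add complex_vector.span_scale)
    qed
    then have "W i ` complex_vector.span (e ` Z) \<subseteq> ?K"
      unfolding closed_cspan_def using closure_subset by blast
    then show ?thesis
      unfolding closed_cspan_def by (intro image_closure_subset continuous_W i) auto
  qed
  have "acts_as_random_walk N V ?K Z e h \<nu>"
    unfolding acts_as_random_walk_def orthonormal_basis_of_def
  proof (intro conjI allI ballI impI sub fin W_K refl)
    show "closed ?K" by (simp add: closed_cspan_def)
    show "cinner (e s) (e t) = (if s = t then 1 else 0)" if "s \<in> Z" "t \<in> Z" for s t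
      using orthonormal[OF fin inv that] .
    show "h i s \<in> Z" "W i (e s) = \<nu> i s *\<^sub>C e (h i s)" if "i < N" "s \<in> Z" for i s
      using hZ(1) adj that by auto
    show "s = t" if "i < N" "s \<in> Z" "t \<in> Z" "\<nu> i s \<noteq> 0" "\<nu> i t \<noteq> 0" "h i s = h i t" for i s t
      using that hZ(2) injective_g by (metis injD)
  qed
  moreover have "irreducible_walk N Z h \<nu>"
    unfolding irreducible_walk_def using minimal_invariant_reaches[OF Z fin] coeff map by metis
  moreover have "separating_walk N Z h \<nu>"
    unfolding separating_walk_def using separation[OF fin inv] coeff by metis
  ultimately show ?thesis by blast
qed

section \<open>The minimum principle and the Parseval identity\<close>

text \<open>Minimum principle: the points of an orbit closure where \<open>\<phi>\<close> is minimal form a compact invariant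
  set, which therefore contains a minimal one.\<close>

lemma harmonic_eq_1:
  fixes \<phi> :: "'t \<Rightarrow> real"
  assumes cont: "continuous_on UNIV \<phi>"
    and harmonic: "\<And>t. \<phi> t = (\<Sum>i<N. (cmod (\<nu> i t))\<^sup>2 * \<phi> (g i t))"
    and le: "\<And>t. \<phi> t \<le> 1"
    and minimal: "\<And>Z t. Z \<in> minimal_sets \<Longrightarrow> t \<in> Z \<Longrightarrow> \<phi> t = 1"
  shows "\<phi> t = 1"
proof -
  let ?K = "orbit_closure t"
  obtain m where m: "m \<in> ?K" "\<And>y. y \<in> ?K \<Longrightarrow> \<phi> m \<le> \<phi> y"
    using continuous_attains_inf[OF compact_orbit_closure _ continuous_on_subset[OF cont]]
      orbit_closure_self[of t] by blast
  define Y where "Y = ?K \<inter> {y. \<phi> y = \<phi> m}"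
  have "compact Y"
    unfolding Y_def
    by (intro compact_Int_closed compact_orbit_closure closed_Collect_eq cont continuous_on_const)
  moreover have "Y \<noteq> {}" using m(1) by (auto simp: Y_def)
  moreover have "invariant_set N g \<nu> Y"
    unfolding invariant_set_def
  proof (intro ballI allI impI)
    fix y i assume y: "y \<in> Y" and i: "i < N" and nz: "\<nu> i y \<noteq> 0"
    have gK: "g j y \<in> ?K" if "j < N" for j
      using orbit_closure_g that y by (auto simp: Y_def)
    \<comment> \<open>This is a weighted mean of nonnegative excesses over the minimum. It is
      \<open>0\<close>, so every possible transition has excess \<open>0\<close>.\<close>
    have "(\<Sum>j<N. (cmod (\<nu> j y))\<^sup>2 * (\<phi> (g j y) - \<phi> m)) = \<phi> y - (\<Sum>j<N. (cmod (\<nu> j y))\<^sup>2) * \<phi> m"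
      by (subst (2) harmonic) (simp add: sum_distrib_right right_diff_distrib sum_subtractf)
    also have "\<dots> = 0" using y by (simp add: nu_sum Y_def)
    finally have "(cmod (\<nu> i y))\<^sup>2 * (\<phi> (g i y) - \<phi> m) = 0"
      using i m(2) gK by (subst (asm) sum_nonneg_eq_0_iff) auto
    then show "g i y \<in> Y"
      using nz gK[OF i] by (simp add: Y_def)
  qed
  ultimately obtain Z where Z: "minimal_compact_invariant_set N g \<nu> Z" "Z \<subseteq> Y"
    by (rule minimal_compact_invariant_subset)
  then obtain z where "z \<in> Z"
    by (auto simp: minimal_compact_invariant_set_def minimal_invariant_set_def)
  then have "\<phi> m = 1"
    using Z minimal[of Z z] by (auto simp: Y_def)
  then show ?thesis
    using m(2)[OF orbit_closure_self] le[of t] by simp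
qed

text \<open>The marked walk lives on the union of all minimal sets and is marked at the chosen
  points; the harmonic function is \<open>\<lambda>t. limit_mass (e t)\<close>.\<close>

lemma parseval:
  assumes bij: "bij_betw M {1..p::nat} minimal_sets" and c: "\<And>j. j \<in> {1..p} \<Longrightarrow> c j \<in> M j"
    and rev: "\<And>j. j \<in> {1..p} \<Longrightarrow> reversing_on N V (M j) e g \<nu>"
  shows "parseval_frame (SIGMA j:{1..p}. words_no_final_cycle N g \<nu> (c j)) (\<lambda>(j, w). word_op V w (e (c j)))"
proof -
  let ?A = "\<Union>j\<in>{1..p}. M j"
  let ?C = "c ` {1..p}"
  have min: "minimal_compact_invariant_set N g \<nu> (M j)" if "j \<in> {1..p}" for j
    using bij that by (auto dest: bij_betwE)
  have inv: "invariant_set N g \<nu> (M j)" if "j \<in> {1..p}" for j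
    using min[OF that] by (simp add: minimal_compact_invariant_set_def minimal_invariant_set_def)
  \<comment> \<open>Different indices give disjoint sets, so a point determines its index.\<close>
  have same: "j = k" if "j \<in> {1..p}" "k \<in> {1..p}" "t \<in> M j" "t \<in> M k" for j k t
  proof -
    have "M j = M k"
      using minimal_compact_invariant_disjoint[OF min[OF that(1)] min[OF that(2)]] that(3,4) by blast
    then show ?thesis
      using bij that(1,2) by (auto simp: bij_betw_def dest: inj_onD)
  qed
  have finA: "finite ?A" using finite_min[OF min] by blast
  have invA: "invariant_set N g \<nu> ?A"
    using inv unfolding invariant_set_def by blast
  interpret marked_walk N V e g \<nu> ?A ?C
  proof unfold_locales
    show "finite ?A" "invariant_set N g \<nu> ?A" by fact+
    show "cinner (e s) (e t) = (if s = t then 1 else 0)" if "s \<in> ?A" "t \<in> ?A" for s t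
      using orthonormal[OF finA invA that] .
    show "inj (g i)" if "i < N" for i using injective_g that .
    show "reversing_on N V ?A e g \<nu>"
      using rev by (auto simp: reversing_on_def)
    show "?C \<subseteq> ?A" using c by blast
    show "\<exists>w\<in>words N. word_map g w s \<in> ?C \<and> word_coeff g \<nu> w s \<noteq> 0" if s: "s \<in> ?A" for s
    proof -
      obtain j where j: "j \<in> {1..p}" "s \<in> M j" using s by blast
      obtain w where "w \<in> words N" "word_map g w s = c j" "word_coeff g \<nu> w s \<noteq> 0"
        using minimal_invariant_reaches[OF min[OF j(1)] finite_min[OF min[OF j(1)]] j(2) c[OF j(1)]] by blast
      then show ?thesis using j(1) by (intro bexI[of _ w]) auto
    qed
    show "word_map g w s = s" if s: "s \<in> ?C" and w: "w \<in> words N" "word_coeff g \<nu> w s \<noteq> 0" "word_map g w s \<in> ?C" for s w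
    proof -
      obtain j k where jk: "j \<in> {1..p}" "k \<in> {1..p}" "s = c j" "word_map g w s = c k"
        using s w(3) by auto
      \<comment> \<open>A possible walk cannot leave the invariant set \<open>M j\<close>, and
        \<open>c j\<close> is the only chosen point there.\<close>
      then have "c k \<in> M j"
        using invariant_set_word_map[OF inv[OF jk(1)] w(1) _ w(2)] c[OF jk(1)] by simp
      then have "j = k" using same[OF jk(1,2)] c[OF jk(2)] by blast
      then show ?thesis using jk by simp
    qed
  qed
  have cont: "continuous_on UNIV (\<lambda>t. limit_mass (e t))"
    by (rule continuous_on_compose2[OF continuous_limit_mass cont_e subset_UNIV])
  have le: "limit_mass (e t) \<le> 1" for t
    using limit_mass_le[of "e t"] by simp
  have one: "limit_mass (e t) = 1" if "Z \<in> minimal_sets" "t \<in> Z" for Z t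
  proof -
    have "Z \<in> M ` {1..p}" using that(1) bij by (simp add: bij_betw_def)
    then have "t \<in> ?A" using that(2) by blast
    then show ?thesis by (rule limit_mass_e_M)
  qed
  have "limit_mass (e t) = 1" for t
    by (rule harmonic_eq_1[OF cont limit_mass_e_harmonic le one])
  then have norm: "limit_mass v = (norm v)\<^sup>2" for v
    using dense_e by (rule limit_mass_eq_norm)
  \<comment> \<open>\<open>frame_has_sum\<close> is indexed by points; injectivity of
    \<open>c\<close> allows replacing the point \<open>c j\<close> by the index
    \<open>j\<close>.\<close>
  have "inj_on c {1..p}"
    using same c by (intro inj_onI) metis
  then have bij_c: "bij_betw (\<lambda>(j, w). (c j, w)) (SIGMA j:{1..p}. words_no_final_cycle N g \<nu> (c j))
      (SIGMA s:?C. words_no_final_cycle N g \<nu> s)"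
    by (intro bij_betwI') (auto dest: inj_onD)
  show ?thesis
    unfolding parseval_frame_def
  proof
    fix v
    show "((\<lambda>j. (cmod (cinner v (case j of (j, w) \<Rightarrow> word_op V w (e (c j)))))\<^sup>2) has_sum (norm v)\<^sup>2)
        (SIGMA j:{1..p}. words_no_final_cycle N g \<nu> (c j))"
      using frame_has_sum[of v] unfolding norm has_sum_reindex_bij_betw[OF bij_c, symmetric]
      by (simp add: case_prod_unfold)
  qed
qed

end

text \<open>The complete list is modelled by an arbitrary bijection from \<open>{1..p}\<close>; the
  separate finiteness claim ensures that one exists for some \<open>p\<close>.\<close>

theorem theorem3p6:
  fixes N :: nat
    and V :: "nat \<Rightarrow> 'k::complex_hilbert \<Rightarrow> 'k"
    and e :: "'t::complete_space \<Rightarrow> 'k"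
    and g :: "nat \<Rightarrow> 't \<Rightarrow> 't"
    and \<nu> :: "nat \<Rightarrow> 't \<Rightarrow> complex"
  assumes "row_coisometry N V"
    and "continuous_on UNIV e"
    and "closed_cspan (range e) = UNIV"
    and "\<forall>t. norm (e t) = 1"
    and "\<forall>i<N. \<forall>t. cadjoint (V i) (e t) = \<nu> i t *\<^sub>C e (g i t)"
    and "\<forall>i<N. is_contraction (g i)"
    and "\<forall>i<N. inj (g i)"
    and "\<forall>S. minimal_compact_invariant_set N g \<nu> S \<longrightarrow> finite S"
  shows "finite {S. minimal_compact_invariant_set N g \<nu> S} \<and>
    (\<forall>(p::nat) (M :: nat \<Rightarrow> 't set) (c :: nat \<Rightarrow> 't).
      bij_betw M {1..p} {S. minimal_compact_invariant_set N g \<nu> S} \<longrightarrow>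
      (\<forall>j\<in>{1..p}. c j \<in> M j) \<longrightarrow>
        (\<forall>j\<in>{1..p}. \<forall>h. is_walk_restriction N g \<nu> (M j) h \<longrightarrow>
          acts_as_random_walk N V (closed_cspan (e ` M j)) (M j) e h \<nu> \<and>
          irreducible_walk N (M j) h \<nu> \<and>
          separating_walk N (M j) h \<nu>) \<and>
        ((\<forall>j\<in>{1..p}. reversing_on N V (M j) e g \<nu>) \<longrightarrow>
          parseval_frame (SIGMA j:{1..p}. words_no_final_cycle N g \<nu> (c j))
            (\<lambda>(j, w). word_op V w (e (c j)))))"
proof -
  interpret contractive_walk N V e g \<nu>
  proof unfold_locales
    show "finite Z" if "minimal_compact_invariant_set N g \<nu> Z" for Z
      using that by (rule assms(8)[rule_format])
  qed (simp_all only: assms(1-7))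
  show ?thesis
  proof (intro conjI allI ballI impI finite_minimal_sets)
    fix p M c j h
    assume bij: "bij_betw M {1..p::nat} minimal_sets" and j: "j \<in> {1..p}"
      and h: "is_walk_restriction N g \<nu> (M j) h"
    have Z: "minimal_compact_invariant_set N g \<nu> (M j)"
      using bspec[OF bij_betwE[OF bij] j] by (rule CollectD)
    show "acts_as_random_walk N V (closed_cspan (e ` M j)) (M j) e h \<nu>"
      "irreducible_walk N (M j) h \<nu>" "separating_walk N (M j) h \<nu>"
      using walk_on_minimal_set[OF Z h] by simp_all
  next
    fix p M c
    assume *: "bij_betw M {1..p::nat} minimal_sets" "\<forall>j\<in>{1..p}. c j \<in> M j"
      "\<forall>j\<in>{1..p}. reversing_on N V (M j) e g \<nu>"
    show "parseval_frame (SIGMA j:{1..p}. words_no_final_cycle N g \<nu> (c j))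
        (\<lambda>(j, w). word_op V w (e (c j)))"
      using *(2,3) by (intro parseval[OF *(1)]) (rule bspec, assumption+)+
  qed
qed

end
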